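(* Let $\{T(t)\}_{t\ge 0}$ be a $C_0$-semigroup (of scalar type spectral operators) on a complex Banach space $(X,\|\cdot\|)$, $X\neq\{0\}$, generated by a scalar type spectral operator $A$ with spectral measure $E_A(\cdot)$. Then $$\|T(t)\|\le 4M_0e^{\omega_0 t},\quad t\ge 0,$$ where $\omega_0=s(A)$ is the best stability constant in the exponent (i.e., $\omega_0=s(A)$ is the smallest $\omega\in\mathbb{R}$ for which there exists $M\ge 1$ with $\|T(t)\|\le Me^{\omega t}$ for all $t\ge 0$) and $$M_0:=\sup_{\delta\in\mathscr{B}(\mathbb{C})}\|E_A(\delta)\|\ge 1.$$
   Context: $\mathscr{B}(\mathbb{C})$ is the Borel $\sigma$-algebra on $\mathbb{C}$. The norm of operators is the operator norm. For a closed linear operator $A$ in $X$, the resolvent set $\rho(A)$ is the set of $\lambda\in\mathbb{C}$ for which $(A-\lambda I)^{-1}$ exists as a bounded linear operator on $X$, and $\sigma(A)=\mathbb{C}\setminus\rho(A)$. Scalar type spectral operator: a densely defined closed linear operator $A$ in $X$ for which there is a strongly $\sigma$-additive spectral measure (resolution of the identity) $E_A(\cdot)$, assigning to each Borel subset of $\mathbb{C}$ a bounded projection operator on $X$ (with $E_A(\emptyset)=0$, $E_A(\mathbb{C})=I$, $E_A(\delta\cap\delta')=E_A(\delta)E_A(\delta')$), having $\sigma(A)$ as its support, and such that $A=\int_{\sigma(A)}\lambda\,dE_A(\lambda)$, i.e., $Af=\lim_{n\to\infty}\int_{\{|\lambda|\le n\}}\lambda\,dE_A(\lambda)f$ with domain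 $D(A)$ consisting of exactly those $f\in X$ for which this limit exists. By strong $\sigma$-additivity, the spectral measure is uniformly bounded. When a scalar type spectral operator $A$ generates a $C_0$-semigroup, the semigroup is $T(t)=e^{tA}=\int_{\sigma(A)}e^{t\lambda}\,dE_A(\lambda)$, $t\ge 0$, and it consists of scalar type spectral operators. Spectral bound: $s(A):=\sup\{\operatorname{Re}\lambda : \lambda\in\sigma(A)\}$ ($-\infty$ if $\sigma(A)=\emptyset$). Growth bound: $\omega_0:=\inf\{\omega\in\mathbb{R} : \exists\, M=M(\omega)\ge 1 \text{ such that } \|T(t)\|\le Me^{\omega t} \text{ for all } t\ge 0\}$. *)

theory Defs
  imports "HOL-Analysis.Analysis"
begin

section \<open>Complex Banach spaces\<close>

text \<open>The libraries provide only real normed spaces as type classes. As \<open>complex_normed_vector\<close>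
  extends \<open>real_normed_vector\<close>, a complex Banach space carries its underlying real structure, and
  \<open>blinfun\<close> is available for bounded operators. Complex linearity of a \<open>blinfun\<close> is an additional
  requirement (\<open>bounded_clinear_op\<close> below).\<close>

class scaleC = scaleR +
  fixes scaleC :: "complex \<Rightarrow> 'a \<Rightarrow> 'a" (infixr "*\<^sub>C" 75)
  assumes scaleC_of_real: "complex_of_real r *\<^sub>C x = r *\<^sub>R x"

class complex_vector = scaleC + real_vector +
  assumes scaleC_add_right: "a *\<^sub>C (x + y) = a *\<^sub>C x + a *\<^sub>C y"
    and scaleC_add_left: "(a + b) *\<^sub>C x = a *\<^sub>C x + b *\<^sub>C x"
    and scaleC_scaleC: "a *\<^sub>C b *\<^sub>C x = (a * b) *\<^sub>C x"
    and scaleC_one: "1 *\<^sub>C x = x"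

class complex_normed_vector = complex_vector + real_normed_vector +
  assumes norm_scaleC: "norm (a *\<^sub>C x) = cmod a * norm x"

class cbanach = complex_normed_vector + banach

instantiation complex :: cbanach
begin

definition scaleC_complex :: "complex \<Rightarrow> complex \<Rightarrow> complex" where
  "scaleC_complex a x = a * x"

instance
  by standard (auto simp: scaleC_complex_def scaleR_conv_of_real algebra_simps norm_mult)

end

lemma bounded_linear_scaleC: "bounded_linear (\<lambda>x. a *\<^sub>C (x :: 'a :: complex_normed_vector))"
proof (rule bounded_linear_intro[where K = "cmod a"])
  show "a *\<^sub>C (r *\<^sub>R x) = r *\<^sub>R (a *\<^sub>C x)" for r and x :: 'a
    by (simp add: scaleC_of_real[symmetric] scaleC_scaleC mult.commute)
qed (simp_all add: scaleC_add_right norm_scaleC mult.commute)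

instantiation blinfun :: (real_normed_vector, complex_normed_vector) complex_normed_vector
begin

lift_definition scaleC_blinfun :: "complex \<Rightarrow> 'a \<Rightarrow>\<^sub>L 'b \<Rightarrow> 'a \<Rightarrow>\<^sub>L 'b"
  is "\<lambda>a f x. a *\<^sub>C f x"
  by (rule bounded_linear_compose[OF bounded_linear_scaleC])

instance
proof
  fix r :: real and a b :: complex and f g :: "'a \<Rightarrow>\<^sub>L 'b"
  show "complex_of_real r *\<^sub>C f = r *\<^sub>R f"
    by transfer (simp add: scaleC_of_real)
  show "a *\<^sub>C (f + g) = a *\<^sub>C f + a *\<^sub>C g"
    by transfer (simp add: scaleC_add_right)
  show "(a + b) *\<^sub>C f = a *\<^sub>C f + b *\<^sub>C f"
    by transfer (simp add: scaleC_add_left)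
  show "a *\<^sub>C b *\<^sub>C f = (a * b) *\<^sub>C f"
    by transfer (simp add: scaleC_scaleC)
  show "1 *\<^sub>C f = f"
    by transfer (simp add: scaleC_one)
  have le: "norm (c *\<^sub>C h) \<le> cmod c * norm h" for c and h :: "'a \<Rightarrow>\<^sub>L 'b"
  proof (rule norm_blinfun_bound)
    fix x
    have "norm (blinfun_apply (c *\<^sub>C h) x) = cmod c * norm (blinfun_apply h x)"
      by (simp add: scaleC_blinfun.rep_eq norm_scaleC)
    also have "\<dots> \<le> cmod c * (norm h * norm x)"
      by (intro mult_left_mono norm_blinfun) simp
    finally show "norm (blinfun_apply (c *\<^sub>C h) x) \<le> cmod c * norm h * norm x"
      by (simp add: mult.assoc)
  qed simp
  show "norm (a *\<^sub>C f) = cmod a * norm f"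
  proof (cases "a = 0")
    case True
    with le[of 0 f] show ?thesis by simp
  next
    case False
    have "inverse a *\<^sub>C a *\<^sub>C f = f"
      using False by transfer (simp add: scaleC_scaleC scaleC_one)
    with le[of "inverse a" "a *\<^sub>C f"] have "norm f \<le> norm (a *\<^sub>C f) / cmod a"
      by (simp add: norm_inverse divide_inverse mult.commute)
    with False have "cmod a * norm f \<le> norm (a *\<^sub>C f)"
      by (simp add: field_simps)
    with le[of a f] show ?thesis by simp
  qed
qed

end

section \<open>Linear operators and their spectrum\<close>

definition bounded_clinear_op :: "('a::complex_normed_vector \<Rightarrow>\<^sub>L 'a) \<Rightarrow> bool" where
  "bounded_clinear_op T \<longleftrightarrow> (\<forall>c x. T (c *\<^sub>C x) = c *\<^sub>C T x)"

text \<open>An unbounded operator is given by its domain \<open>D\<close> and a function \<open>A\<close> whose values outside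
  \<open>D\<close> are irrelevant.\<close>

definition linear_operator :: "'a::complex_normed_vector set \<Rightarrow> ('a \<Rightarrow> 'a) \<Rightarrow> bool" where
  "linear_operator D A \<longleftrightarrow>
     0 \<in> D \<and>
     (\<forall>x\<in>D. \<forall>y\<in>D. x + y \<in> D \<and> A (x + y) = A x + A y) \<and>
     (\<forall>c. \<forall>x\<in>D. c *\<^sub>C x \<in> D \<and> A (c *\<^sub>C x) = c *\<^sub>C A x)"

definition closed_operator :: "'a::complex_normed_vector set \<Rightarrow> ('a \<Rightarrow> 'a) \<Rightarrow> bool" where
  "closed_operator D A \<longleftrightarrow> linear_operator D A \<and> closed ((\<lambda>x. (x, A x)) ` D)"

definition densely_defined :: "'a::complex_normed_vector set \<Rightarrow> bool" where
  "densely_defined D \<longleftrightarrow> closure D = UNIV"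

definition resolvent_set :: "'a::complex_normed_vector set \<Rightarrow> ('a \<Rightarrow> 'a) \<Rightarrow> complex set" where
  "resolvent_set D A = {z. \<exists>R :: 'a \<Rightarrow>\<^sub>L 'a. bounded_clinear_op R \<and>
     (\<forall>x. R x \<in> D \<and> A (R x) - z *\<^sub>C R x = x) \<and>
     (\<forall>x\<in>D. R (A x - z *\<^sub>C x) = x)}"

definition spectrum :: "'a::complex_normed_vector set \<Rightarrow> ('a \<Rightarrow> 'a) \<Rightarrow> complex set" where
  "spectrum D A = - resolvent_set D A"

definition spectral_bound :: "'a::complex_normed_vector set \<Rightarrow> ('a \<Rightarrow> 'a) \<Rightarrow> ereal" where
  "spectral_bound D A = (SUP z\<in>spectrum D A. ereal (Re z))"

section \<open>Spectral measures and scalar type spectral operators\<close>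

text \<open>Only the values of \<open>E\<close> on Borel sets matter. The values are projections, because the
  multiplicativity with \<open>\<delta> = \<delta>'\<close> gives \<open>E \<delta> o\<^sub>L E \<delta> = E \<delta>\<close>.\<close>

definition spectral_measure :: "(complex set \<Rightarrow> 'a::complex_normed_vector \<Rightarrow>\<^sub>L 'a) \<Rightarrow> bool" where
  "spectral_measure E \<longleftrightarrow>
     (\<forall>\<delta>\<in>sets borel. bounded_clinear_op (E \<delta>)) \<and>
     E {} = 0 \<and> E UNIV = id_blinfun \<and>
     (\<forall>\<delta>\<in>sets borel. \<forall>\<delta>'\<in>sets borel. E (\<delta> \<inter> \<delta>') = E \<delta> o\<^sub>L E \<delta>') \<and>
     (\<forall>\<delta> :: nat \<Rightarrow> complex set. range \<delta> \<subseteq> sets borel \<longrightarrow> disjoint_family \<delta> \<longrightarrow>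
        (\<forall>x. (\<lambda>n. E (\<delta> n) x) sums E (\<Union>n. \<delta> n) x))"

definition spectral_support :: "(complex set \<Rightarrow> 'a::complex_normed_vector \<Rightarrow>\<^sub>L 'a) \<Rightarrow> complex set" where
  "spectral_support E = - \<Union>{U. open U \<and> E U = 0}"

definition simple_spectral_integral ::
    "(complex set \<Rightarrow> 'a::complex_normed_vector \<Rightarrow>\<^sub>L 'a) \<Rightarrow> (complex \<Rightarrow> complex) \<Rightarrow> 'a \<Rightarrow>\<^sub>L 'a" where
  "simple_spectral_integral E s = (\<Sum>c\<in>range s. c *\<^sub>C E (s -` {c}))"

text \<open>For bounded Borel functions: the limit, in operator norm, of the integrals of simple
  functions converging uniformly to the integrand.\<close>

definition has_bounded_spectral_integral ::
    "(complex set \<Rightarrow> 'a::complex_normed_vector \<Rightarrow>\<^sub>L 'a) \<Rightarrow> (complex \<Rightarrow> complex) \<Rightarrow> ('a \<Rightarrow>\<^sub>L 'a) \<Rightarrow> bool" where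
  "has_bounded_spectral_integral E F S \<longleftrightarrow>
     (\<exists>s :: nat \<Rightarrow> complex \<Rightarrow> complex. (\<forall>n. simple_function borel (s n)) \<and>
        uniform_limit UNIV s F sequentially \<and>
        (\<lambda>n. simple_spectral_integral E (s n)) \<longlonglongrightarrow> S)"

text \<open>\<open>has_spectral_integral E \<Omega> F x y\<close> says that \<open>x\<close> lies in the domain of \<open>\<integral>\<^sub>\<Omega> F dE\<close> and that
  \<open>y\<close> is the limit of the integrals of \<open>F\<close> over \<open>{z \<in> \<Omega>. |F z| \<le> n}\<close> applied to \<open>x\<close>.\<close>

definition has_spectral_integral ::
    "(complex set \<Rightarrow> 'a::complex_normed_vector \<Rightarrow>\<^sub>L 'a) \<Rightarrow> complex set \<Rightarrow> (complex \<Rightarrow> complex)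
      \<Rightarrow> 'a \<Rightarrow> 'a \<Rightarrow> bool" where
  "has_spectral_integral E \<Omega> F x y \<longleftrightarrow>
     (\<exists>S :: nat \<Rightarrow> 'a \<Rightarrow>\<^sub>L 'a.
        (\<forall>n. has_bounded_spectral_integral E
               (\<lambda>z. if z \<in> \<Omega> \<and> cmod (F z) \<le> real n then F z else 0) (S n)) \<and>
        (\<lambda>n. S n x) \<longlonglongrightarrow> y)"

definition scalar_type_spectral ::
    "'a::complex_normed_vector set \<Rightarrow> ('a \<Rightarrow> 'a) \<Rightarrow> (complex set \<Rightarrow> 'a \<Rightarrow>\<^sub>L 'a) \<Rightarrow> bool" where
  "scalar_type_spectral D A E \<longleftrightarrow>
     densely_defined D \<and> closed_operator D A \<and>
     spectral_measure E \<and> spectral_support E = spectrum D A \<and>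
     (\<forall>x y. x \<in> D \<and> A x = y \<longleftrightarrow> has_spectral_integral E (spectrum D A) (\<lambda>z. z) x y)"

section \<open>Semigroups\<close>

definition C0_semigroup :: "(real \<Rightarrow> 'a::complex_normed_vector \<Rightarrow>\<^sub>L 'a) \<Rightarrow> bool" where
  "C0_semigroup T \<longleftrightarrow>
     (\<forall>t\<ge>0. bounded_clinear_op (T t)) \<and>
     T 0 = id_blinfun \<and>
     (\<forall>s\<ge>0. \<forall>t\<ge>0. T (s + t) = T s o\<^sub>L T t) \<and>
     (\<forall>x. ((\<lambda>t. T t x) \<longlongrightarrow> x) (at_right 0))"

definition generates ::
    "'a::complex_normed_vector set \<Rightarrow> ('a \<Rightarrow> 'a) \<Rightarrow> (real \<Rightarrow> 'a \<Rightarrow>\<^sub>L 'a) \<Rightarrow> bool" where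
  "generates D A T \<longleftrightarrow>
     (\<forall>x y. x \<in> D \<and> A x = y \<longleftrightarrow> ((\<lambda>h. (T h x - x) /\<^sub>R h) \<longlongrightarrow> y) (at_right 0))"

definition growth_exponents :: "(real \<Rightarrow> 'a::complex_normed_vector \<Rightarrow>\<^sub>L 'a) \<Rightarrow> real set" where
  "growth_exponents T = {\<omega>. \<exists>M\<ge>1. \<forall>t\<ge>0. norm (T t) \<le> M * exp (\<omega> * t)}"

definition growth_bound :: "(real \<Rightarrow> 'a::complex_normed_vector \<Rightarrow>\<^sub>L 'a) \<Rightarrow> ereal" where
  "growth_bound T = (INF \<omega>\<in>growth_exponents T. ereal \<omega>)"

end

theory Submission
  imports Defs
begin

text \<open>
  The formula \<open>T t = \<integral> exp (t z) dE z\<close> explains both halves of the theorem, but the hypotheses tie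
  \<open>T\<close> to \<open>E\<close> only through the common generator \<open>A\<close>. The proof recovers as much of the formula as the
  two bounds require, by comparing \<open>T\<close> with finite exponential sums
  \<open>\<Sum>i. exp (t c\<^sub>i) v\<^sub>i\<close>. If the \<open>v\<^sub>i\<close> are in the domain and nearly satisfy \<open>A v\<^sub>i = c\<^sub>i v\<^sub>i\<close>, such a
  sum nearly solves the same evolution equation as \<open>T t (\<Sum>i. v\<^sub>i)\<close>, and the error is controlled by
  the mean value inequality (\<open>semigroup_comparison\<close>).

  Lower bound. The spectrum is the support of \<open>E\<close>, so the spectral projection of every disc around a
  point \<open>\<mu>\<close> of the spectrum is nonzero, and a small disc yields unit vectors \<open>x\<close> with \<open>A x - \<mu> x\<close>
  arbitrarily small. Comparing \<open>T t x\<close> with \<open>exp (t \<mu>) x\<close> gives \<open>exp (t Re \<mu>) \<le> \<parallel>T t\<parallel>\<close>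
  (\<open>exp_Re_spectrum_le_norm_semigroup\<close>). Hence no growth exponent is smaller than the spectral bound
  \<open>s\<close>. Since some exponential bound for \<open>T\<close> exists, \<open>s < \<infinity>\<close>; and the spectrum is nonempty, as \<open>E\<close> does
  not vanish and is concentrated on its support.

  Upper bound. Let \<open>x\<close> be in the range of \<open>E b\<close> for a bounded Borel subset \<open>b\<close> of the spectrum, where
  \<open>A\<close> acts as a bounded operator \<open>B\<close>, the integral of \<open>z\<close> over \<open>b\<close>. A simple function near \<open>z\<close> on \<open>b\<close>
  cuts \<open>x\<close> into pieces \<open>v\<^sub>c = E (d\<^sub>c) x\<close> on which \<open>A\<close> is nearly the scalar \<open>c\<close>, and the comparison
  sum is \<open>\<Sum>c. exp (t c) E (d\<^sub>c) x\<close>. Finite sums of this kind obey the estimate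
  \<open>\<parallel>\<Sum>c. a\<^sub>c E (d\<^sub>c)\<parallel> \<le> 4 M sup \<bar>a\<^sub>c\<bar>\<close> for every bound \<open>M\<close> of the norms of the projections
  (\<open>norm_spectral_sum_le\<close>), whence \<open>\<parallel>T t x\<parallel> \<le> 4 M exp (s t) \<parallel>x\<parallel>\<close>. Vectors of this kind are dense.

  The number \<open>4\<close> comes from convexity: for coefficients in \<open>[0, 1]\<close> the operator
  \<open>\<Sum>c. a\<^sub>c E (d\<^sub>c)\<close> is a convex combination of projections \<open>E \<delta>\<close>, hence bounded by \<open>M\<close>; a complex
  coefficient of modulus at most \<open>1\<close> is a combination of four such numbers, the positive and
  negative parts of its real and imaginary part.
\<close>

section \<open>Preliminaries on Banach spaces\<close>

lemma bounded_bilinear_scaleC: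
  "bounded_bilinear (scaleC :: complex \<Rightarrow> 'a::complex_normed_vector \<Rightarrow> 'a)"
proof
  fix a b :: complex and x y :: 'a and r :: real
  show "(r *\<^sub>R a) *\<^sub>C x = r *\<^sub>R (a *\<^sub>C x)"
    by (simp flip: scaleC_of_real[where x = x for x :: 'a] add: scaleC_scaleC scaleR_conv_of_real)
  show "a *\<^sub>C (r *\<^sub>R x) = r *\<^sub>R (a *\<^sub>C x)"
    by (simp add: scaleC_of_real[symmetric] scaleC_scaleC mult.commute)
  show "\<exists>K. \<forall>(a::complex) (x::'a). norm (a *\<^sub>C x) \<le> norm a * norm x * K"
    by (intro exI[of _ 1]) (simp add: norm_scaleC)
qed (simp_all add: scaleC_add_left scaleC_add_right)

interpretation scaleC: bounded_bilinear "scaleC :: complex \<Rightarrow> 'a::complex_normed_vector \<Rightarrow> 'a"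
  by (rule bounded_bilinear_scaleC)

declare scaleC.zero_left [simp] scaleC.zero_right [simp]

text \<open>By Baire's theorem one of the closed sets on which the whole family is bounded by a fixed \<open>n\<close>
  contains a ball; differences of points of the ball then cover all directions.\<close>

theorem uniform_boundedness:
  fixes \<F> :: "('a::banach \<Rightarrow>\<^sub>L 'b::real_normed_vector) set"
  assumes pointwise: "\<And>x. \<exists>K. \<forall>f\<in>\<F>. norm (f x) \<le> K"
  obtains K where "\<And>f. f \<in> \<F> \<Longrightarrow> norm f \<le> K"
proof -
  define C where "C n = {x. \<forall>f\<in>\<F>. norm (blinfun_apply f x) \<le> real n}" for n
  have closed: "closed (C n)" for n
  proof -
    have "C n = (\<Inter>f\<in>\<F>. {x. norm (blinfun_apply f x) \<le> real n})"
      by (auto simp: C_def)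
    thus ?thesis by (auto intro!: closed_Collect_le continuous_intros)
  qed
  have "(\<Union>n. C n) = UNIV"
  proof (intro equalityI subsetI UNIV_I)
    fix x
    obtain K where K: "\<forall>f\<in>\<F>. norm (blinfun_apply f x) \<le> K" using pointwise by blast
    obtain n where "K \<le> real n" using real_arch_simple by blast
    with K have "x \<in> C n" by (auto simp: C_def intro: order_trans)
    thus "x \<in> (\<Union>n. C n)" by blast
  qed
  hence "interior (\<Union>n. C n) \<noteq> {}" by simp
  moreover have "Met_TC.mcomplete (TYPE('a))" by (simp add: mcomplete_iff_complete complete_UNIV)
  ultimately obtain n where "interior (C n) \<noteq> {}"
    using Met_TC.metric_Baire_category_alt[of "range C"] closed by (auto simp flip: interior_of_eq)
  then obtain a e where e: "e > 0" and ball: "cball a e \<subseteq> C n"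
    by (meson ex_in_conv mem_interior_cball)
  show ?thesis
  proof (rule that)
    fix f assume f: "f \<in> \<F>"
    show "norm f \<le> 2 * real n / e"
    proof (rule norm_blinfun_bound)
      fix x :: 'a
      show "norm (f x) \<le> 2 * real n / e * norm x"
      proof (cases "x = 0")
        case False
        \<comment> \<open>Rescale \<open>x\<close> so that \<open>a + y\<close> lies on the boundary of the ball around \<open>a\<close>.\<close>
        define y where "y = (e / norm x) *\<^sub>R x"
        have "norm y = e" using e False by (simp add: y_def)
        hence "a + y \<in> C n" "a \<in> C n" using ball e by (auto simp: subset_iff dist_norm)
        hence "norm (f (a + y)) \<le> n" "norm (f a) \<le> n" using f by (auto simp: C_def)
        moreover have "f y = f (a + y) - f a" by (simp add: blinfun.add_right)
        ultimately have "norm (f y) \<le> 2 * real n"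
          using norm_triangle_ineq4[of "f (a + y)" "f a"] by simp
        moreover have "norm (f y) = e / norm x * norm (f x)"
          using e by (simp add: y_def blinfun.scaleR_right)
        ultimately show ?thesis using e False by (simp add: field_simps)
      qed simp
    qed (use e in simp)
  qed
qed

section \<open>Spectral measures\<close>

lemma spectral_measureD:
  assumes "spectral_measure E"
  shows spectral_measure_empty: "E {} = 0"
    and spectral_measure_UNIV: "E UNIV = id_blinfun"
    and spectral_measure_Int: "\<And>a b. a \<in> sets borel \<Longrightarrow> b \<in> sets borel \<Longrightarrow> E (a \<inter> b) = E a o\<^sub>L E b"
    and spectral_measure_scaleC: "\<And>a c x. a \<in> sets borel \<Longrightarrow> E a (c *\<^sub>C x) = c *\<^sub>C E a x"
    and spectral_measure_sums: "\<And>d x. range d \<subseteq> sets borel \<Longrightarrow> disjoint_family d \<Longrightarrow>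
      (\<lambda>n::nat. E (d n) x) sums E (\<Union>n. d n) x"
  using assms unfolding spectral_measure_def bounded_clinear_op_def by auto

lemma spectral_measure_apply:
  assumes "spectral_measure E" "a \<in> sets borel" "b \<in> sets borel"
  shows "E a (E b x) = E (a \<inter> b) x"
  using spectral_measure_Int[OF assms] by simp

lemma spectral_measure_Un:
  assumes E: "spectral_measure E" and a: "a \<in> sets borel" and b: "b \<in> sets borel" and "a \<inter> b = {}"
  shows "E (a \<union> b) = E a + E b"
proof (rule blinfun_eqI)
  fix x
  have "(\<lambda>n. E (binaryset a b n) x) sums E (\<Union>n. binaryset a b n) x"
    using assms by (intro spectral_measure_sums[OF E])
      (auto simp: range_binaryset_eq disjoint_family_on_def binaryset_def)
  moreover have "(\<lambda>n. E (binaryset a b n) x) sums (E a x + E b x)"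
    by (rule binaryset_sums) (simp add: spectral_measure_empty[OF E])
  ultimately show "E (a \<union> b) x = (E a + E b) x"
    by (simp add: UN_binaryset_eq sums_unique2 blinfun.add_left)
qed

lemma spectral_measure_UN_finite:
  assumes E: "spectral_measure E" and "finite I"
    and "\<And>i. i \<in> I \<Longrightarrow> d i \<in> sets borel" and "disjoint_family_on d I"
  shows "E (\<Union>i\<in>I. d i) = (\<Sum>i\<in>I. E (d i))"
  using assms(2-4)
proof (induction I rule: finite_induct)
  case empty
  thus ?case by (simp add: spectral_measure_empty[OF E])
next
  case (insert i I)
  have "d i \<inter> (\<Union>j\<in>I. d j) = {}"
    using insert.prems insert.hyps by (auto simp: disjoint_family_on_def)
  hence "E (d i \<union> (\<Union>j\<in>I. d j)) = E (d i) + E (\<Union>j\<in>I. d j)"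
    using insert by (intro spectral_measure_Un[OF E] sets.finite_UN) auto
  with insert show ?case by (simp add: disjoint_family_on_def)
qed

lemma spectral_measure_LIMSEQ:
  assumes E: "spectral_measure E" and d: "\<And>n. d n \<in> sets borel" and "mono d"
  shows "(\<lambda>n::nat. E (d n) x) \<longlonglongrightarrow> E (\<Union>n. d n) x"
proof -
  have meas: "disjointed d n \<in> sets borel" for n
    using d sets.range_disjointed_sets'[of d borel] by auto
  have "(\<lambda>n. E (disjointed d n) x) sums E (\<Union>n. disjointed d n) x"
    using meas by (intro spectral_measure_sums[OF E]) (auto simp: disjoint_family_disjointed)
  hence "(\<lambda>n. \<Sum>i<Suc n. E (disjointed d i) x) \<longlonglongrightarrow> E (\<Union>n. d n) x"
    unfolding sums_def UN_disjointed_eq by (rule LIMSEQ_Suc)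
  moreover have "(\<Sum>i<Suc n. E (disjointed d i) x) = E (d n) x" for n
  proof -
    have "(\<Sum>i<Suc n. E (disjointed d i)) = E (\<Union>i<Suc n. disjointed d i)"
      using meas disjoint_family_disjointed[of d]
      by (intro spectral_measure_UN_finite[OF E, symmetric])
         (auto simp: disjoint_family_on_def)
    also have "(\<Union>i<Suc n. disjointed d i) = (\<Union>i<Suc n. d i)"
      using finite_UN_disjointed_eq[of d "Suc n"] by (simp add: atLeast0LessThan)
    also have "\<dots> = d n"
      using \<open>mono d\<close> by (auto simp: mono_def less_Suc_eq_le subset_iff)
    finally show ?thesis by (simp flip: blinfun.sum_left)
  qed
  ultimately show ?thesis by simp
qed

text \<open>If the vector measure \<open>\<delta> \<mapsto> E \<delta> x\<close> were unbounded on the subsets of a set \<open>b\<close>, then \<open>b\<close> could be cut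
  in two pieces on both of which the measure has norm at least \<open>1\<close>, and it would remain unbounded on
  the subsets of one of them. Cutting that piece again, and so on, the discarded pieces form a
  disjoint sequence whose measures do not tend to \<open>0\<close>, against \<open>\<sigma>\<close>-additivity.\<close>

lemma spectral_measure_bounded_on_orbit:
  assumes E: "spectral_measure E"
  shows "\<exists>K. \<forall>\<delta>\<in>sets borel. norm (E \<delta> x) \<le> K"
proof (rule ccontr)
  define bad where "bad b \<longleftrightarrow> b \<in> sets borel \<and> (\<forall>K. \<exists>\<delta>\<in>sets borel. \<delta> \<subseteq> b \<and> norm (E \<delta> x) > K)" for b
  assume "\<not> ?thesis"
  hence "bad UNIV" by (auto simp: bad_def not_le)
  have split: "\<exists>c. bad c \<and> c \<subseteq> b \<and> norm (E (b - c) x) \<ge> 1" if bad_b: "bad b" for b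
  proof -
    have b: "b \<in> sets borel" using bad_b by (simp add: bad_def)
    obtain d where d: "d \<in> sets borel" "d \<subseteq> b" and big: "norm (E d x) > norm (E b x) + 1"
      using bad_b unfolding bad_def by meson
    have add: "E u x = E (u \<inter> d) x + E (u - d) x" if "u \<in> sets borel" for u
    proof -
      have "E u = E (u \<inter> d) + E (u - d)"
        using spectral_measure_Un[OF E, of "u \<inter> d" "u - d"] that d
        by (simp add: Int_Diff_Un Int_Diff_disjoint)
      thus ?thesis by (simp add: blinfun.add_left)
    qed
    have "E b x = E d x + E (b - d) x"
      using add[OF b] d by (simp add: inf_absorb2)
    hence "norm (E (b - d) x) \<ge> 1"
      using big norm_triangle_ineq4[of "E b x" "E (b - d) x"] by simp
    moreover have "norm (E d x) \<ge> 1" using big norm_ge_zero[of "E b x"] by linarith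
    moreover have "bad d \<or> bad (b - d)"
    proof (rule ccontr)
      assume "\<not> (bad d \<or> bad (b - d))"
      then obtain K L where
        K: "\<forall>\<delta>\<in>sets borel. \<delta> \<subseteq> d \<longrightarrow> norm (E \<delta> x) \<le> K" and
        L: "\<forall>\<delta>\<in>sets borel. \<delta> \<subseteq> b - d \<longrightarrow> norm (E \<delta> x) \<le> L"
        using b d by (auto simp: bad_def not_less)
      obtain u where u: "u \<in> sets borel" "u \<subseteq> b" "norm (E u x) > K + L"
        using bad_b by (auto simp: bad_def)
      have "u \<inter> d \<in> sets borel" "u - d \<in> sets borel" using u(1) d(1) by auto
      moreover have "u \<inter> d \<subseteq> d" "u - d \<subseteq> b - d" using u(2) by auto
      ultimately have "norm (E (u \<inter> d) x) \<le> K" "norm (E (u - d) x) \<le> L"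
        using K L by blast+
      thus False
        using u(3) norm_triangle_ineq[of "E (u \<inter> d) x" "E (u - d) x"] by (simp add: add[OF u(1)])
    qed
    \<comment> \<open>Either \<open>c = d\<close> or \<open>c = b - d\<close> serves; the other piece is then \<open>b - c\<close>.\<close>
    moreover have "b - (b - d) = d" using d by auto
    ultimately show ?thesis using d by (metis Diff_subset)
  qed
  obtain c where c: "\<And>n::nat. bad (c n)"
    "\<And>n. c (Suc n) \<subseteq> c n \<and> norm (E (c n - c (Suc n)) x) \<ge> 1"
  proof -
    have "\<exists>c. bad c" using \<open>bad UNIV\<close> by blast
    moreover have "\<exists>b'. bad b' \<and> (b' \<subseteq> b \<and> norm (E (b - b') x) \<ge> 1)" if "bad b" for b
      using split[OF that] .
    ultimately obtain c where "\<forall>n::nat. bad (c n) \<and> (c (Suc n) \<subseteq> c n \<and> norm (E (c n - c (Suc n)) x) \<ge> 1)"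
      using dependent_nat_choice[of "\<lambda>_. bad" "\<lambda>_ b b'. b' \<subseteq> b \<and> norm (E (b - b') x) \<ge> 1"]
      by metis
    thus ?thesis by (intro that[of c]) auto
  qed
  have "antimono c" using c(2) by (auto simp: antimono_iff_le_Suc)
  hence "(c m - c (Suc m)) \<inter> (c n - c (Suc n)) = {}" if "m < n" for m n
    using antimonoD[of c "Suc m" n] that by auto
  hence "disjoint_family (\<lambda>n. c n - c (Suc n))"
    unfolding disjoint_family_on_def by (metis inf.commute linorder_neqE_nat)
  moreover have "range (\<lambda>n. c n - c (Suc n)) \<subseteq> sets borel" using c(1) by (auto simp: bad_def)
  ultimately have "(\<lambda>n. E (c n - c (Suc n)) x) sums E (\<Union>n. c n - c (Suc n)) x"
    by (intro spectral_measure_sums[OF E])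
  hence lim: "(\<lambda>n. E (c n - c (Suc n)) x) \<longlonglongrightarrow> 0"
    by (intro summable_LIMSEQ_zero) (rule sums_summable)
  have "eventually (\<lambda>n. norm (E (c n - c (Suc n)) x) < 1) sequentially"
    using order_tendstoD(2)[OF tendsto_norm_zero[OF lim], of 1] by simp
  thus False using c(2) by (auto simp: eventually_sequentially not_less[symmetric])
qed

theorem spectral_measure_bounded:
  fixes E :: "complex set \<Rightarrow> 'a::cbanach \<Rightarrow>\<^sub>L 'a"
  assumes "spectral_measure E"
  shows "bdd_above ((\<lambda>\<delta>. norm (E \<delta>)) ` sets borel)"
proof -
  have "\<exists>K. \<forall>f\<in>E ` sets borel. norm (blinfun_apply f x) \<le> K" for x
    using spectral_measure_bounded_on_orbit[OF assms] by simp
  then obtain K where "\<And>f. f \<in> E ` sets borel \<Longrightarrow> norm f \<le> K"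
    by (rule uniform_boundedness) blast
  thus ?thesis by (auto intro!: bdd_aboveI2)
qed

section \<open>Finite spectral sums\<close>

text \<open>The sum is affine in each \<open>p i\<close> separately, so its norm is largest when all \<open>p i\<close> are \<open>0\<close> or \<open>1\<close>, and
  then it is a single projection \<open>E \<delta>\<close>. The additional set \<open>b\<close> collects the indices whose coefficient
  has already been moved to \<open>1\<close>.\<close>

lemma norm_unit_interval_combination_le:
  assumes E: "spectral_measure E" and M: "\<And>\<delta>. \<delta> \<in> sets borel \<Longrightarrow> norm (E \<delta>) \<le> M"
    and "finite I" and "\<And>i. i \<in> I \<Longrightarrow> d i \<in> sets borel" and "disjoint_family_on d I"
    and "\<And>i. i \<in> I \<Longrightarrow> 0 \<le> p i \<and> p i \<le> 1"
    and "b \<in> sets borel" and "\<And>i. i \<in> I \<Longrightarrow> b \<inter> d i = {}"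
  shows "norm (E b + (\<Sum>i\<in>I. p i *\<^sub>R E (d i))) \<le> M"
  using assms(3-)
proof (induction I arbitrary: b rule: finite_induct)
  case empty
  thus ?case using M by simp
next
  case (insert i I)
  let ?S = "\<Sum>j\<in>I. p j *\<^sub>R E (d j)"
  have disj: "disjoint_family_on d I" using insert.prems by (simp add: disjoint_family_on_def)
  have p: "0 \<le> p i" "p i \<le> 1" using insert.prems by auto
  have 1: "norm (E b + ?S) \<le> M"
    using insert disj by (intro insert.IH) auto
  have "(b \<union> d i) \<inter> d j = {}" if "j \<in> I" for j
    using that insert.prems insert.hyps by (auto simp: disjoint_family_on_def)
  hence "norm (E (b \<union> d i) + ?S) \<le> M"
    using insert disj by (intro insert.IH) auto
  hence 2: "norm (E b + E (d i) + ?S) \<le> M"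
    using spectral_measure_Un[OF E, of b "d i"] insert.prems by simp
  have "E b + (\<Sum>j\<in>insert i I. p j *\<^sub>R E (d j))
      = (1 - p i) *\<^sub>R (E b + ?S) + p i *\<^sub>R (E b + E (d i) + ?S)"
    using insert.hyps by (simp add: algebra_simps)
  also have "norm \<dots> \<le> (1 - p i) * norm (E b + ?S) + p i * norm (E b + E (d i) + ?S)"
    using p by (intro norm_triangle_le) simp
  also have "\<dots> \<le> (1 - p i) * M + p i * M"
    using 1 2 p by (intro add_mono mult_left_mono) auto
  finally show ?case by (simp add: algebra_simps)
qed

text \<open>Here the constant \<open>4\<close> of the theorem arises: \<open>c i / K\<close> is split into the positive and negative parts
  of its real and imaginary part, four numbers in \<open>[0, 1]\<close>.\<close>

lemma norm_spectral_sum_le: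
  assumes E: "spectral_measure E" and M: "\<And>\<delta>. \<delta> \<in> sets borel \<Longrightarrow> norm (E \<delta>) \<le> M"
    and I: "finite I" "\<And>i. i \<in> I \<Longrightarrow> d i \<in> sets borel" "disjoint_family_on d I"
    and c: "\<And>i. i \<in> I \<Longrightarrow> cmod (c i) \<le> K" and "K \<ge> 0"
  shows "norm (\<Sum>i\<in>I. c i *\<^sub>C E (d i)) \<le> 4 * M * K"
proof (cases "K = 0")
  case True
  thus ?thesis using c by simp
next
  case False
  with \<open>K \<ge> 0\<close> have K: "K > 0" by simp
  define S where "S p = (\<Sum>i\<in>I. p i *\<^sub>R E (d i))" for p
  have S: "norm (S p) \<le> M" if "\<And>i. i \<in> I \<Longrightarrow> 0 \<le> p i \<and> p i \<le> 1" for p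
    using norm_unit_interval_combination_le[OF E M I that, where b = "{}"] spectral_measure_empty[OF E]
    by (simp add: S_def)
  define re im where "re i = Re (c i) / K" and "im i = Im (c i) / K" for i
  have re_im: "\<bar>re i\<bar> \<le> 1" "\<bar>im i\<bar> \<le> 1" if "i \<in> I" for i
    using c[OF that] K abs_Re_le_cmod[of "c i"] abs_Im_le_cmod[of "c i"]
    by (auto simp: re_def im_def)
  have c_eq: "c i = of_real K * (of_real (max 0 (re i)) - of_real (max 0 (- re i))
      + \<i> * (of_real (max 0 (im i)) - of_real (max 0 (- im i))))" for i
    using K by (auto simp: complex_eq_iff re_def im_def max_def field_simps)
  have decomp: "(\<Sum>i\<in>I. c i *\<^sub>C E (d i)) = K *\<^sub>R (S (\<lambda>i. max 0 (re i)) - S (\<lambda>i. max 0 (- re i))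
      + \<i> *\<^sub>C (S (\<lambda>i. max 0 (im i)) - S (\<lambda>i. max 0 (- im i))))"
    unfolding S_def
    by (subst c_eq)
       (simp add: scaleC.add_left scaleC.diff_left scaleC.add_right scaleC.diff_right scaleC.sum_right
          sum.distrib sum_subtractf scaleR_right.sum scaleR_add_right scaleR_diff_right
          flip: scaleC_of_real scaleC_scaleC)
  have "norm (\<Sum>i\<in>I. c i *\<^sub>C E (d i)) \<le> K * (norm (S (\<lambda>i. max 0 (re i))) + norm (S (\<lambda>i. max 0 (- re i)))
      + (norm (S (\<lambda>i. max 0 (im i))) + norm (S (\<lambda>i. max 0 (- im i)))))"
    unfolding decomp
    using K by (auto simp: norm_scaleC intro!: norm_triangle_mono norm_triangle_ineq4)
  also have "\<dots> \<le> K * (M + M + (M + M))"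
    using re_im K by (intro mult_left_mono add_mono S) fastforce+
  finally show ?thesis by (simp add: algebra_simps)
qed

section \<open>Spectral integrals of simple and bounded functions\<close>

text \<open>A spectral integral may be computed on any finite partition on which the integrand is constant, not
  only on its own level sets. Applied to a pair \<open>h\<close> of simple functions, this provides a common
  refinement.\<close>

lemma simple_spectral_integral_comp:
  assumes E: "spectral_measure E" and h: "simple_function borel h"
  shows "simple_spectral_integral E (\<lambda>z. g (h z)) = (\<Sum>v\<in>range h. g v *\<^sub>C E (h -` {v}))"
proof -
  have fin: "finite (range h)" and meas: "\<And>v. h -` {v} \<in> sets borel"
    using simple_functionD[OF h] by auto
  have "E ((\<lambda>z. g (h z)) -` {c}) = (\<Sum>v\<in>{v\<in>range h. g v = c}. E (h -` {v}))" for c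
  proof -
    have "(\<lambda>z. g (h z)) -` {c} = (\<Union>v\<in>{v\<in>range h. g v = c}. h -` {v})" by auto
    thus ?thesis
      using fin meas by (simp only:, intro spectral_measure_UN_finite[OF E])
        (auto simp: disjoint_family_on_def)
  qed
  hence "simple_spectral_integral E (\<lambda>z. g (h z))
      = (\<Sum>c\<in>g ` range h. \<Sum>v\<in>{v\<in>range h. g v = c}. g v *\<^sub>C E (h -` {v}))"
    unfolding simple_spectral_integral_def
    by (auto simp: scaleC.sum_right image_image intro!: sum.cong)
  also have "\<dots> = (\<Sum>v\<in>range h. g v *\<^sub>C E (h -` {v}))"
    by (rule sum.image_gen[OF fin, symmetric])
  finally show ?thesis .
qed

lemma norm_simple_spectral_integral_le:
  assumes E: "spectral_measure E" and M: "\<And>\<delta>. \<delta> \<in> sets borel \<Longrightarrow> norm (E \<delta>) \<le> M"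
    and s: "simple_function borel s" and "\<And>z. cmod (s z) \<le> K"
  shows "norm (simple_spectral_integral E s) \<le> 4 * M * K"
  unfolding simple_spectral_integral_def
  using simple_functionD[OF s] assms(4) order_trans[OF norm_ge_zero assms(4)]
  by (intro norm_spectral_sum_le[OF E M]) (auto simp: disjoint_family_on_def)

lemma simple_spectral_integral_diff:
  assumes E: "spectral_measure E" and f: "simple_function borel f" and g: "simple_function borel g"
  shows "simple_spectral_integral E (\<lambda>z. f z - g z)
    = simple_spectral_integral E f - simple_spectral_integral E g"
proof -
  define h where "h = (\<lambda>z. (f z, g z))"
  have h: "simple_function borel h" unfolding h_def by (rule simple_function_Pair[OF f g])
  have "simple_spectral_integral E (\<lambda>z. fst (h z) - snd (h z))
      = simple_spectral_integral E (\<lambda>z. fst (h z)) - simple_spectral_integral E (\<lambda>z. snd (h z))"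
    unfolding simple_spectral_integral_comp[OF E h, of "\<lambda>v. fst v - snd v"]
      simple_spectral_integral_comp[OF E h, of fst] simple_spectral_integral_comp[OF E h, of snd]
    by (simp add: scaleC.diff_left sum_subtractf)
  thus ?thesis by (simp add: h_def)
qed

text \<open>This is where multiplicativity of \<open>E\<close> enters the calculus: the level sets of the restriction are
  intersections with \<open>b\<close>.\<close>

lemma simple_spectral_integral_restrict:
  assumes E: "spectral_measure E" and f: "simple_function borel f" and b: "b \<in> sets borel"
  shows "simple_spectral_integral E (\<lambda>z. if z \<in> b then f z else 0)
    = simple_spectral_integral E f o\<^sub>L E b"
proof -
  \<comment> \<open>The value \<open>0\<close> may be taken by \<open>f\<close> inside \<open>b\<close> too, so membership in \<open>b\<close> is recorded separately.\<close>
  define h where "h = (\<lambda>z. (f z, z \<in> b))"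
  have "simple_function borel (\<lambda>z. z \<in> b)"
    unfolding simple_function_def
  proof (intro conjI ballI)
    fix t
    have "(\<lambda>z. z \<in> b) -` {t} = (if t then b else - b)" by auto
    thus "(\<lambda>z. z \<in> b) -` {t} \<inter> space borel \<in> sets borel" using b by simp
  qed simp
  hence h: "simple_function borel h" unfolding h_def by (rule simple_function_Pair[OF f])
  have fin: "finite (range f)" and meas: "\<And>c. f -` {c} \<in> sets borel"
    using simple_functionD[OF f] by auto
  have E0: "E (h -` {(c, True)}) = 0" if "(c, True) \<notin> range h" for c
  proof -
    have "h z \<noteq> (c, True)" for z using that rangeI[of h z] by metis
    hence "h -` {(c, True)} = {}" by auto
    thus ?thesis by (simp add: spectral_measure_empty[OF E])
  qed
  have "simple_spectral_integral E (\<lambda>z. if z \<in> b then f z else 0)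
      = simple_spectral_integral E (\<lambda>z. (\<lambda>(c, t). if t then c else 0) (h z))"
    by (rule arg_cong[where f = "simple_spectral_integral E"]) (auto simp: h_def)
  also have "\<dots> = (\<Sum>v\<in>range h. (\<lambda>(c, t). if t then c else 0) v *\<^sub>C E (h -` {v}))"
    by (rule simple_spectral_integral_comp[OF E h])
  also have "\<dots> = (\<Sum>v\<in>(\<lambda>c. (c, True)) ` range f. fst v *\<^sub>C E (h -` {v}))"
    using simple_functionD(1)[OF h] fin E0
    by (intro sum.mono_neutral_cong) (auto simp: h_def scaleC.zero_left)
  also have "\<dots> = (\<Sum>c\<in>range f. c *\<^sub>C E (h -` {(c, True)}))"
    by (subst sum.reindex) (auto simp: inj_on_def)
  also have "\<dots> = (\<Sum>c\<in>range f. c *\<^sub>C (E (f -` {c}) o\<^sub>L E b))"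
  proof (intro sum.cong refl)
    fix c
    have "h -` {(c, True)} = f -` {c} \<inter> b" by (auto simp: h_def)
    thus "c *\<^sub>C E (h -` {(c, True)}) = c *\<^sub>C (E (f -` {c}) o\<^sub>L E b)"
      using meas b by (simp add: spectral_measure_Int[OF E])
  qed
  also have "\<dots> = simple_spectral_integral E f o\<^sub>L E b"
    unfolding simple_spectral_integral_def
    by (rule blinfun_eqI) (simp add: blinfun.sum_left scaleC_blinfun.rep_eq)
  finally show ?thesis .
qed

lemma has_bounded_spectral_integral_diff:
  assumes E: "spectral_measure E"
    and "has_bounded_spectral_integral E F S" and "has_bounded_spectral_integral E G S'"
  shows "has_bounded_spectral_integral E (\<lambda>z. F z - G z) (S - S')"
proof -
  obtain f where f: "\<forall>n. simple_function borel (f n)" "uniform_limit UNIV f F sequentially"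
    "(\<lambda>n. simple_spectral_integral E (f n)) \<longlonglongrightarrow> S"
    using assms(2) by (auto simp: has_bounded_spectral_integral_def)
  obtain g where g: "\<forall>n. simple_function borel (g n)" "uniform_limit UNIV g G sequentially"
    "(\<lambda>n. simple_spectral_integral E (g n)) \<longlonglongrightarrow> S'"
    using assms(3) by (auto simp: has_bounded_spectral_integral_def)
  have "(\<lambda>n. simple_spectral_integral E (\<lambda>z. f n z - g n z)) \<longlonglongrightarrow> S - S'"
    using tendsto_diff[OF f(3) g(3)] f(1) g(1) by (simp add: simple_spectral_integral_diff[OF E])
  thus ?thesis
    unfolding has_bounded_spectral_integral_def
    using f g by (intro exI[of _ "\<lambda>n z. f n z - g n z"])
      (auto intro!: uniform_limit_intros simple_function_diff)
qed

lemma has_bounded_spectral_integral_restrict: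
  assumes E: "spectral_measure E" and b: "b \<in> sets borel"
    and "has_bounded_spectral_integral E F S"
  shows "has_bounded_spectral_integral E (\<lambda>z. if z \<in> b then F z else 0) (S o\<^sub>L E b)"
proof -
  obtain f where f: "\<forall>n. simple_function borel (f n)" "uniform_limit UNIV f F sequentially"
    "(\<lambda>n. simple_spectral_integral E (f n)) \<longlonglongrightarrow> S"
    using assms(3) by (auto simp: has_bounded_spectral_integral_def)
  have "(\<lambda>n. simple_spectral_integral E (\<lambda>z. if z \<in> b then f n z else 0)) \<longlonglongrightarrow> (S o\<^sub>L E b)"
    using f b by (auto simp: simple_spectral_integral_restrict[OF E] intro!: tendsto_intros
        bounded_bilinear.tendsto[OF bounded_bilinear_blinfun_compose])
  moreover have "uniform_limit UNIV (\<lambda>n z. if z \<in> b then f n z else 0)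
      (\<lambda>z. if z \<in> b then F z else 0) sequentially"
    using f(2) unfolding uniform_limit_iff by (auto elim!: eventually_mono)
  moreover have "simple_function borel (\<lambda>z. if z \<in> b then f n z else 0)" for n
    using f(1) b by (intro simple_function_If_set) auto
  ultimately show ?thesis
    unfolding has_bounded_spectral_integral_def
    by (intro exI[of _ "\<lambda>n z. if z \<in> b then f n z else 0"]) blast
qed

lemma has_bounded_spectral_integral_simple:
  "simple_function borel s \<Longrightarrow> has_bounded_spectral_integral E s (simple_spectral_integral E s)"
  unfolding has_bounded_spectral_integral_def
  by (intro exI[of _ "\<lambda>_. s"]) (auto simp: uniform_limit_iff)

lemma has_bounded_spectral_integral_const_on:
  assumes E: "spectral_measure E" and b: "b \<in> sets borel"
  shows "has_bounded_spectral_integral E (\<lambda>z. if z \<in> b then c else 0) (c *\<^sub>C E b)"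
proof -
  have "simple_spectral_integral E (\<lambda>_. c) = c *\<^sub>C id_blinfun"
    by (simp add: simple_spectral_integral_def spectral_measure_UNIV[OF E])
  moreover have "(c *\<^sub>C id_blinfun) o\<^sub>L E b = c *\<^sub>C E b"
    by (rule blinfun_eqI) (simp add: scaleC_blinfun.rep_eq)
  moreover have "has_bounded_spectral_integral E (\<lambda>_. c) (simple_spectral_integral E (\<lambda>_. c))"
    by (rule has_bounded_spectral_integral_simple) simp
  ultimately show ?thesis
    using has_bounded_spectral_integral_restrict[OF E b, of "\<lambda>_. c"] by metis
qed

text \<open>The approximating simple functions need not respect the bound \<open>K\<close>, but they exceed it by less than
  any \<open>e > 0\<close> in the long run.\<close>

theorem norm_bounded_spectral_integral_le:
  assumes E: "spectral_measure E" and M: "\<And>\<delta>. \<delta> \<in> sets borel \<Longrightarrow> norm (E \<delta>) \<le> M"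
    and "has_bounded_spectral_integral E F S" and F: "\<And>z. cmod (F z) \<le> K"
  shows "norm S \<le> 4 * M * K"
proof -
  obtain f where f: "\<forall>n. simple_function borel (f n)" "uniform_limit UNIV f F sequentially"
    "(\<lambda>n. simple_spectral_integral E (f n)) \<longlonglongrightarrow> S"
    using assms(3) by (auto simp: has_bounded_spectral_integral_def)
  have "norm S \<le> 4 * M * (K + e)" if "e > 0" for e
  proof -
    have "\<forall>\<^sub>F n in sequentially. \<forall>z\<in>UNIV. dist (f n z) (F z) < e"
      using f(2) that by (simp add: uniform_limit_iff)
    hence "\<forall>\<^sub>F n in sequentially. norm (simple_spectral_integral E (f n)) \<le> 4 * M * (K + e)"
    proof eventually_elim
      case (elim n)
      have "cmod (f n z) \<le> K + e" for z
      proof -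
        have "cmod (f n z) \<le> cmod (F z) + cmod (f n z - F z)" by (rule norm_triangle_sub)
        also have "\<dots> \<le> K + e" using F[of z] elim[rule_format, of z] by (simp add: dist_norm)
        finally show ?thesis .
      qed
      thus ?case using f(1) by (intro norm_simple_spectral_integral_le[OF E M]) auto
    qed
    thus ?thesis using tendsto_upperbound[OF tendsto_norm[OF f(3)]] by simp
  qed
  hence "\<forall>\<^sub>F e in at_right 0. norm S \<le> 4 * M * (K + e)"
    by (intro eventually_at_right_less[THEN eventually_mono]) auto
  moreover have "((\<lambda>e. 4 * M * (K + e)) \<longlongrightarrow> 4 * M * (K + 0)) (at_right 0)"
    by (intro tendsto_intros)
  ultimately show ?thesis
    using tendsto_lowerbound[of "\<lambda>e. 4 * M * (K + e)"] by simp
qed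

lemma bounded_spectral_integral_unique:
  fixes E :: "complex set \<Rightarrow> 'a::cbanach \<Rightarrow>\<^sub>L 'a"
  assumes E: "spectral_measure E"
    and "has_bounded_spectral_integral E F S" and "has_bounded_spectral_integral E F S'"
  shows "S = S'"
proof -
  obtain M where M: "\<And>\<delta>. \<delta> \<in> sets borel \<Longrightarrow> norm (E \<delta>) \<le> M"
    using spectral_measure_bounded[OF E] by (auto simp: bdd_above_def)
  have "norm (S - S') \<le> 4 * M * 0"
    by (rule norm_bounded_spectral_integral_le[OF E M has_bounded_spectral_integral_diff[OF assms]])
      simp_all
  thus ?thesis by simp
qed

section \<open>Strongly continuous semigroups\<close>

lemma C0_semigroupD:
  assumes "C0_semigroup T"
  shows C0_semigroup_0: "T 0 = id_blinfun"
    and C0_semigroup_add: "\<And>s t. s \<ge> 0 \<Longrightarrow> t \<ge> 0 \<Longrightarrow> T (s + t) = T s o\<^sub>L T t"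
    and C0_semigroup_tendsto: "\<And>x. ((\<lambda>t. T t x) \<longlongrightarrow> x) (at_right 0)"
    and C0_semigroup_scaleC: "\<And>t c x. t \<ge> 0 \<Longrightarrow> T t (c *\<^sub>C x) = c *\<^sub>C T t x"
  using assms unfolding C0_semigroup_def bounded_clinear_op_def by auto

text \<open>Otherwise there are \<open>t\<^sub>n \<rightarrow> 0\<close> with \<open>\<parallel>T t\<^sub>n\<parallel> > n\<close>; but \<open>T t\<^sub>n x \<rightarrow> x\<close> is bounded for each \<open>x\<close>, which
  contradicts uniform boundedness.\<close>

lemma C0_semigroup_bounded_near_0:
  fixes T :: "real \<Rightarrow> 'a::cbanach \<Rightarrow>\<^sub>L 'a"
  assumes T: "C0_semigroup T"
  obtains d K where "d > 0" "K \<ge> 1" "\<And>t. 0 \<le> t \<Longrightarrow> t \<le> d \<Longrightarrow> norm (T t) \<le> K"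
proof -
  have "\<exists>d>0. \<exists>K. \<forall>t\<in>{0<..<d}. norm (T t) \<le> K"
  proof (rule ccontr)
    assume contr: "\<not> ?thesis"
    have "\<exists>t. 0 < t \<and> t < inverse (real (Suc n)) \<and> norm (T t) > real n" for n
    proof (rule ccontr)
      assume "\<not> ?thesis"
      hence "\<forall>t\<in>{0<..<inverse (real (Suc n))}. norm (T t) \<le> real n" by force
      moreover have "inverse (real (Suc n)) > 0" by simp
      ultimately show False using contr by blast
    qed
    then obtain t where t: "\<And>n. 0 < t n" "\<And>n. t n < inverse (real (Suc n))"
      "\<And>n. norm (T (t n)) > real n"
      by metis
    have "t \<longlonglongrightarrow> 0"
      by (rule tendsto_sandwich[OF _ _ tendsto_const LIMSEQ_inverse_real_of_nat])
         (auto intro!: always_eventually less_imp_le t simp del: of_nat_Suc)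
    hence lim: "filterlim t (at_right 0) sequentially"
      using t(1) by (auto simp: filterlim_at less_imp_neq[THEN not_sym] intro!: always_eventually)
    have "\<exists>K. \<forall>f\<in>range (\<lambda>n. T (t n)). norm (blinfun_apply f x) \<le> K" for x
    proof -
      have "Bseq (\<lambda>n. T (t n) x)"
        using filterlim_compose[OF C0_semigroup_tendsto[OF T] lim] convergentI convergent_imp_Bseq
        by blast
      thus ?thesis by (auto simp: Bseq_def)
    qed
    then obtain K where "\<And>f. f \<in> range (\<lambda>n. T (t n)) \<Longrightarrow> norm f \<le> K"
      by (rule uniform_boundedness) blast
    hence K: "norm (T (t n)) \<le> K" for n by blast
    obtain n where "K \<le> real n" using real_arch_simple by blast
    with K[of n] t(3)[of n] show False by linarith
  qed
  then obtain d K where dK: "d > 0" "\<forall>t\<in>{0<..<d}. norm (T t) \<le> K" by blast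
  show ?thesis
  proof (rule that)
    fix t assume "0 \<le> t" "t \<le> d / 2"
    hence "t = 0 \<or> norm (T t) \<le> K" using dK by auto
    moreover have "norm (T 0) \<le> 1"
      using norm_blinfun_id_le by (simp add: C0_semigroup_0[OF T])
    ultimately show "norm (T t) \<le> max 1 K" by auto
  qed (use dK in auto)
qed

text \<open>Writing \<open>t = n d + r\<close> with \<open>0 \<le> r \<le> d\<close> and a bound \<open>K\<close> on \<open>[0, d]\<close>, one has
  \<open>\<parallel>T t\<parallel> \<le> K\<^bsup>n+1\<^esup>\<close> and \<open>n \<le> t / d\<close>.\<close>

lemma C0_semigroup_exponential_bound:
  fixes T :: "real \<Rightarrow> 'a::cbanach \<Rightarrow>\<^sub>L 'a"
  assumes T: "C0_semigroup T"
  obtains \<omega> K where "\<omega> \<ge> 0" "K \<ge> 1" "\<And>t. t \<ge> 0 \<Longrightarrow> norm (T t) \<le> K * exp (\<omega> * t)"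
proof -
  obtain d K where d: "d > 0" and K: "K \<ge> 1" and le: "\<And>t. 0 \<le> t \<Longrightarrow> t \<le> d \<Longrightarrow> norm (T t) \<le> K"
    using C0_semigroup_bounded_near_0[OF T] by metis
  have pow: "norm (T (of_nat n * d + r)) \<le> K * K ^ n" if "0 \<le> r" "r \<le> d" for n r
  proof (induction n)
    case 0
    thus ?case using le that by simp
  next
    case (Suc n)
    have "T (of_nat (Suc n) * d + r) = T d o\<^sub>L T (of_nat n * d + r)"
      using C0_semigroup_add[OF T, of d "of_nat n * d + r"] d that by (simp add: algebra_simps)
    hence "norm (T (of_nat (Suc n) * d + r)) \<le> norm (T d) * norm (T (of_nat n * d + r))"
      by (simp add: norm_blinfun_compose)
    also have "\<dots> \<le> K * (K * K ^ n)"
      using le[of d] d K Suc by (intro mult_mono) auto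
    finally show ?case by simp
  qed
  show ?thesis
  proof (rule that)
    show "ln K / d \<ge> 0" "K \<ge> 1" using K d by auto
    fix t :: real assume t: "t \<ge> 0"
    define n where "n = nat \<lfloor>t / d\<rfloor>"
    have n: "real n = of_int \<lfloor>t / d\<rfloor>" using t d by (simp add: n_def)
    have n': "real n \<le> t / d" "t / d \<le> real n + 1" unfolding n by linarith+
    hence "0 \<le> t - real n * d" "t - real n * d \<le> d" using d by (auto simp: field_simps)
    from pow[OF this, of n] have "norm (T t) \<le> K * K ^ n" by simp
    also have "K ^ n = exp (ln K * real n)" using K by (simp add: mult.commute exp_of_nat_mult)
    also have "\<dots> \<le> exp (ln K * (t / d))" using n' K by (intro iffD2[OF exp_le_cancel_iff] mult_left_mono) auto
    finally show "norm (T t) \<le> K * exp (ln K / d * t)" using K by simp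
  qed
qed

lemma C0_semigroup_locally_bounded:
  fixes T :: "real \<Rightarrow> 'a::cbanach \<Rightarrow>\<^sub>L 'a"
  assumes T: "C0_semigroup T"
  obtains K where "K \<ge> 1" "\<And>r. 0 \<le> r \<Longrightarrow> r \<le> t \<Longrightarrow> norm (T r) \<le> K"
proof -
  obtain \<omega> K where *: "\<omega> \<ge> 0" "K \<ge> 1" "\<And>t. t \<ge> 0 \<Longrightarrow> norm (T t) \<le> K * exp (\<omega> * t)"
    using C0_semigroup_exponential_bound[OF T] by metis
  show ?thesis
  proof (rule that)
    fix r assume r: "0 \<le> r" "r \<le> t"
    have "norm (T r) \<le> K * exp (\<omega> * r)" using * r by simp
    also have "\<dots> \<le> K * exp (\<omega> * \<bar>t\<bar>)" using * r by (intro mult_left_mono) (auto intro: mult_left_mono)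
    finally show "norm (T r) \<le> K * exp (\<omega> * \<bar>t\<bar>)" .
  next
    have "1 * 1 \<le> K * exp (\<omega> * \<bar>t\<bar>)" using * by (intro mult_mono) auto
    thus "1 \<le> K * exp (\<omega> * \<bar>t\<bar>)" by simp
  qed
qed

text \<open>Factoring out the semigroup at the smaller of the two times turns differences to the left and to the
  right of \<open>s\<close> alike into the one-sided difference quotient at \<open>0\<close>.\<close>

lemma C0_semigroup_diff:
  assumes T: "C0_semigroup T" and "0 \<le> r" "0 \<le> s" "r \<noteq> s"
  shows "T r x - T s x = (r - s) *\<^sub>R T (min r s) ((T \<bar>r - s\<bar> x - x) /\<^sub>R \<bar>r - s\<bar>)"
proof -
  have "T (min r s + \<bar>r - s\<bar>) = T (min r s) o\<^sub>L T \<bar>r - s\<bar>"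
    using assms by (intro C0_semigroup_add[OF T]) auto
  moreover have "min r s + \<bar>r - s\<bar> = max r s" by auto
  ultimately have "T (max r s) x = T (min r s) (T \<bar>r - s\<bar> x)" by simp
  moreover have "(r - s) *\<^sub>R T (min r s) (y /\<^sub>R \<bar>r - s\<bar>) = sgn (r - s) *\<^sub>R T (min r s) y" for y
    by (simp add: blinfun.scaleR_right sgn_div_norm)
  ultimately show ?thesis
    using \<open>r \<noteq> s\<close> by (cases "r \<le> s") (auto simp: blinfun.diff_right min_def max_def)
qed

lemma abs_diff_at_right_0:
  fixes s :: real
  shows "filterlim (\<lambda>r. \<bar>r - s\<bar>) (at_right 0) (at s within S)"
proof -
  have "((\<lambda>r. \<bar>r - s\<bar>) \<longlongrightarrow> \<bar>s - s\<bar>) (at s within S)" by (intro tendsto_intros)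
  thus ?thesis
    by (auto simp: filterlim_at eventually_at_filter intro!: always_eventually)
qed

lemma C0_semigroup_continuous_on:
  fixes T :: "real \<Rightarrow> 'a::cbanach \<Rightarrow>\<^sub>L 'a"
  assumes T: "C0_semigroup T"
  shows "continuous_on {0..t} (\<lambda>r. T r x)"
  unfolding continuous_on_def
proof
  fix s assume s: "s \<in> {0..t}"
  obtain K where K: "K \<ge> 1" "\<And>r. 0 \<le> r \<Longrightarrow> r \<le> t \<Longrightarrow> norm (T r) \<le> K"
    using C0_semigroup_locally_bounded[OF T] by metis
  have "((\<lambda>r. T \<bar>r - s\<bar> x - x) \<longlongrightarrow> x - x) (at s within {0..t})"
    by (intro tendsto_intros filterlim_compose[OF C0_semigroup_tendsto[OF T] abs_diff_at_right_0])
  hence "((\<lambda>r. K * norm (T \<bar>r - s\<bar> x - x)) \<longlongrightarrow> K * norm (x - x)) (at s within {0..t})"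
    by (intro tendsto_mult tendsto_const tendsto_norm)
  hence lim: "((\<lambda>r. K * norm (T \<bar>r - s\<bar> x - x)) \<longlongrightarrow> 0) (at s within {0..t})" by simp
  have "norm (T r x - T s x) \<le> K * norm (T \<bar>r - s\<bar> x - x)" if "r \<in> {0..t}" "r \<noteq> s" for r
  proof -
    have "norm (T r x - T s x) = norm (T (min r s) (T \<bar>r - s\<bar> x - x))"
      using that s by (subst C0_semigroup_diff[OF T]) (auto simp: blinfun.scaleR_right abs_mult)
    also have "\<dots> \<le> norm (T (min r s)) * norm (T \<bar>r - s\<bar> x - x)" by (rule norm_blinfun)
    also have "\<dots> \<le> K * norm (T \<bar>r - s\<bar> x - x)"
      using K that s by (intro mult_right_mono) auto
    finally show ?thesis .
  qed
  hence "\<forall>\<^sub>F r in at s within {0..t}. norm (T r x - T s x) \<le> K * norm (T \<bar>r - s\<bar> x - x)"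
    unfolding eventually_at_filter by (intro always_eventually) blast
  from Lim_null_comparison[OF this lim]
  have "((\<lambda>r. T r x - T s x) \<longlongrightarrow> 0) (at s within {0..t})" .
  thus "((\<lambda>r. T r x) \<longlongrightarrow> T s x) (at s within {0..t})" by (simp add: LIM_zero_iff)
qed

text \<open>The generator is defined by a one-sided derivative at \<open>0\<close>, whereas the mean value inequality needs
  the derivative within the whole interval. The left derivative costs a little: there the semigroup
  factor \<open>T (min r s)\<close> varies with \<open>r\<close>, and local boundedness and strong continuity are used.\<close>

lemma C0_semigroup_has_vector_derivative:
  fixes T :: "real \<Rightarrow> 'a::cbanach \<Rightarrow>\<^sub>L 'a"
  assumes T: "C0_semigroup T" and gen: "generates D A T" and v: "v \<in> D" and s: "s \<in> {0..t}"
  shows "((\<lambda>r. T r v) has_vector_derivative T s (A v)) (at s within {0..t})"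
proof -
  obtain K where K: "K \<ge> 1" "\<And>r. 0 \<le> r \<Longrightarrow> r \<le> t \<Longrightarrow> norm (T r) \<le> K"
    using C0_semigroup_locally_bounded[OF T] by metis
  define q where "q h = (T h v - v) /\<^sub>R h" for h
  \<comment> \<open>\<open>H\<close> dominates the norm of the difference quotient minus its limit.\<close>
  define H where "H r = K * norm (q \<bar>r - s\<bar> - A v) + norm (T (min r s) (A v) - T s (A v))" for r
  have "(q \<longlongrightarrow> A v) (at_right 0)"
    using gen v unfolding generates_def q_def by blast
  hence "((\<lambda>r. q \<bar>r - s\<bar>) \<longlongrightarrow> A v) (at s within {0..t})"
    by (rule filterlim_compose[OF _ abs_diff_at_right_0])
  moreover have "((\<lambda>r. T (min r s) (A v)) \<longlongrightarrow> T s (A v)) (at s within {0..t})"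
  proof -
    have "continuous_on {0..t} (\<lambda>r. T (min r s) (A v))"
      using s by (intro continuous_on_compose2[OF C0_semigroup_continuous_on[OF T, of t]])
        (auto intro!: continuous_intros)
    thus ?thesis using s by (force simp: continuous_on_def)
  qed
  ultimately have "(H \<longlongrightarrow> K * norm (A v - A v) + norm (T s (A v) - T s (A v))) (at s within {0..t})"
    unfolding H_def by (intro tendsto_add tendsto_mult tendsto_norm tendsto_diff tendsto_const)
  hence H: "(H \<longlongrightarrow> 0) (at s within {0..t})" by simp
  show ?thesis
    unfolding has_vector_derivative_def
  proof (rule has_derivativeI_sandwich[OF zero_less_one _ _ H])
    fix r assume r: "r \<in> {0..t}" "r \<noteq> s"
    have "T r v - T s v - (r - s) *\<^sub>R T s (A v)
        = (r - s) *\<^sub>R (T (min r s) (q \<bar>r - s\<bar> - A v) + (T (min r s) (A v) - T s (A v)))"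
      using r s by (subst C0_semigroup_diff[OF T])
        (auto simp: q_def blinfun.diff_right scaleR_diff_right)
    hence "norm (T r v - T s v - (r - s) *\<^sub>R T s (A v)) / norm (r - s)
        = norm (T (min r s) (q \<bar>r - s\<bar> - A v) + (T (min r s) (A v) - T s (A v)))"
      using r by simp
    also have "\<dots> \<le> norm (T (min r s) (q \<bar>r - s\<bar> - A v)) + norm (T (min r s) (A v) - T s (A v))"
      by (rule norm_triangle_ineq)
    also have "norm (T (min r s) (q \<bar>r - s\<bar> - A v)) \<le> norm (T (min r s)) * norm (q \<bar>r - s\<bar> - A v)"
      by (rule norm_blinfun)
    also have "\<dots> \<le> K * norm (q \<bar>r - s\<bar> - A v)"
      using K r s by (intro mult_right_mono) auto
    finally show "norm (T r v - T s v - (r - s) *\<^sub>R T s (A v)) / norm (r - s) \<le> H r"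
      by (simp add: H_def)
  qed (rule bounded_linear_scaleR_left)
qed

section \<open>Comparison with exponential sums\<close>

text \<open>This is Duhamel's principle. The function \<open>w r = \<Sum>i. exp (r c\<^sub>i) T (t - r) v\<^sub>i\<close> interpolates between
  \<open>T t (\<Sum>i. v\<^sub>i)\<close> at \<open>r = 0\<close> and the exponential sum at \<open>r = t\<close>, and its derivative is the
  expression bounded by \<open>L\<close>, which measures how far the \<open>v\<^sub>i\<close> are from being eigenvectors.\<close>

lemma semigroup_comparison:
  fixes T :: "real \<Rightarrow> 'a::cbanach \<Rightarrow>\<^sub>L 'a"
  assumes T: "C0_semigroup T" and gen: "generates D A T" and "t \<ge> 0"
    and v: "\<And>i. i \<in> I \<Longrightarrow> v i \<in> D"
    and L: "\<And>r. 0 \<le> r \<Longrightarrow> r \<le> t \<Longrightarrow>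
      norm (T (t - r) (\<Sum>i\<in>I. exp (of_real r * c i) *\<^sub>C (c i *\<^sub>C v i - A (v i)))) \<le> L"
  shows "norm ((\<Sum>i\<in>I. exp (of_real t * c i) *\<^sub>C v i) - T t (\<Sum>i\<in>I. v i)) \<le> L * t"
proof -
  define w where "w r = (\<Sum>i\<in>I. exp (of_real r * c i) *\<^sub>C T (t - r) (v i))" for r
  define w' where
    "w' r = (\<Sum>i\<in>I. exp (of_real r * c i) *\<^sub>C - T (t - r) (A (v i))
                + (c i * exp (of_real r * c i)) *\<^sub>C T (t - r) (v i))" for r
  have w': "w' r = T (t - r) (\<Sum>i\<in>I. exp (of_real r * c i) *\<^sub>C (c i *\<^sub>C v i - A (v i)))"
    if "r \<le> t" for r
    using that C0_semigroup_scaleC[OF T, of "t - r"]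
    by (simp add: w'_def blinfun.sum_right blinfun.diff_right scaleC.diff_right scaleC.minus_right
        scaleC_scaleC algebra_simps)
  have "(w has_vector_derivative w' r) (at r within {0..t})" if r: "r \<in> {0..t}" for r
  proof -
    have exp': "((\<lambda>r. exp (of_real r * c i)) has_vector_derivative c i * exp (of_real r * c i))
        (at r within {0..t})" for i
    proof -
      have "((\<lambda>z. exp (z * c i)) has_field_derivative c i * exp (of_real r * c i)) (at (of_real r))"
        by (auto intro!: derivative_eq_intros)
      thus ?thesis by (rule has_vector_derivative_real_field)
    qed
    have T': "((\<lambda>r. T (t - r) (v i)) has_vector_derivative - T (t - r) (A (v i))) (at r within {0..t})"
      if "i \<in> I" for i
    proof -
      have "((\<lambda>r. T r (v i)) has_vector_derivative T (t - r) (A (v i)))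
          (at (t - r) within (\<lambda>r. t - r) ` {0..t})"
        using r by (intro has_vector_derivative_within_subset[OF
            C0_semigroup_has_vector_derivative[OF T gen v[OF that], of _ t]]) auto
      moreover have "((\<lambda>r. t - r) has_vector_derivative -1) (at r within {0..t})"
        by (auto intro!: derivative_eq_intros)
      ultimately show ?thesis
        using vector_diff_chain_within[of "\<lambda>r. t - r" "-1" r "{0..t}" "\<lambda>r. T r (v i)"]
        by (simp add: o_def)
    qed
    show ?thesis
      unfolding w_def w'_def
      by (intro has_vector_derivative_sum)
         (rule bounded_bilinear.has_vector_derivative[OF bounded_bilinear_scaleC exp' T'])
  qed
  moreover have "norm (w' r) \<le> L" if "r \<in> {0..t}" for r
    using that L w' by simp
  moreover have "onorm (\<lambda>h. h *\<^sub>R w' r) \<le> L" if "norm (w' r) \<le> L" for r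
    using that by (intro onorm_le) (simp add: mult_left_mono mult.commute[of L])
  ultimately have "norm (w t - w 0) \<le> L * norm (t - 0)"
    using \<open>t \<ge> 0\<close> unfolding has_vector_derivative_def
    by (intro differentiable_bound[where S = "{0..t}" and f' = "\<lambda>r h. h *\<^sub>R w' r"]) auto
  moreover have "w t = (\<Sum>i\<in>I. exp (of_real t * c i) *\<^sub>C v i)"
    by (simp add: w_def C0_semigroup_0[OF T])
  moreover have "w 0 = T t (\<Sum>i\<in>I. v i)"
    by (simp add: w_def blinfun.sum_right scaleC_one)
  ultimately show ?thesis using \<open>t \<ge> 0\<close> by simp
qed

section \<open>The bounded parts of a scalar type spectral operator\<close>

text \<open>The complement of the support is a union of open null sets. By the Lindelof property countably many
  of them suffice, and \<open>\<sigma>\<close>-additivity applies once they are made disjoint.\<close>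

lemma spectral_measure_null_Compl_support:
  assumes E: "spectral_measure E"
  shows "E (- spectral_support E) = 0"
proof -
  define \<U> where "\<U> = {U. open U \<and> E U = 0}"
  have supp: "- spectral_support E = \<Union>\<U>"
    by (simp add: spectral_support_def \<U>_def)
  obtain \<V> where \<V>: "\<V> \<subseteq> \<U>" "countable \<V>" "\<Union>\<V> = \<Union>\<U>"
    using Lindelof[of \<U>] unfolding \<U>_def by (metis (no_types, lifting) mem_Collect_eq)
  show ?thesis
  proof (cases "\<V> = {}")
    case True
    hence "- spectral_support E = {}" using \<V>(3) by (auto simp: supp)
    thus ?thesis by (simp only: spectral_measure_empty[OF E])
  next
    case False
    define V where "V = from_nat_into \<V>"
    have V: "V n \<in> sets borel" "E (V n) = 0" for n
      using from_nat_into[OF False, of n] \<V>(1) by (auto simp: V_def \<U>_def)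
    have d: "disjointed V n \<in> sets borel" for n
      using V sets.range_disjointed_sets'[of V borel] by auto
    have "E (disjointed V n) = 0" for n
      using spectral_measure_Int[OF E d V(1), of n n] V disjointed_subset[of V n]
      by (simp add: inf_absorb1)
    moreover have "(\<lambda>n. E (disjointed V n) x) sums E (\<Union>n. disjointed V n) x" for x
      using d by (intro spectral_measure_sums[OF E]) (auto simp: disjoint_family_disjointed)
    ultimately have "E (\<Union>n. V n) x = 0" for x
      using sums_unique2[OF sums_zero] by (auto simp: UN_disjointed_eq)
    hence "E (\<Union>n. V n) = 0" by (intro blinfun_eqI) simp
    moreover have "(\<Union>n. V n) = - spectral_support E"
      using \<V> False by (simp add: V_def supp)
    ultimately show ?thesis by simp
  qed
qed

lemma closed_spectral_support: "closed (spectral_support E)"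
  unfolding spectral_support_def by (auto simp: closed_def)

lemma scalar_type_spectral_Int_spectrum:
  assumes "scalar_type_spectral D A E" and b: "b \<in> sets borel"
  shows "spectrum D A \<in> sets borel" "E (b \<inter> spectrum D A) = E b"
proof -
  have E: "spectral_measure E" and supp: "spectral_support E = spectrum D A"
    using assms by (auto simp: scalar_type_spectral_def)
  show meas: "spectrum D A \<in> sets borel"
    using closed_spectral_support[of E] by (simp add: supp)
  have "id_blinfun = E (- spectrum D A) + E (spectrum D A)"
    using spectral_measure_Un[OF E, of "- spectrum D A" "spectrum D A"] meas
    by (simp add: spectral_measure_UNIV[OF E])
  hence "E (spectrum D A) = id_blinfun"
    using spectral_measure_null_Compl_support[OF E] by (simp add: supp)
  thus "E (b \<inter> spectrum D A) = E b"
    by (intro blinfun_eqI) (simp add: spectral_measure_Int[OF E b meas])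
qed

text \<open>The truncated integrals that define \<open>A x\<close> become constant, as the truncation at level \<open>n\<close> no longer
  affects \<open>b\<close> once \<open>b\<close> lies in the disc of radius \<open>n\<close>. So \<open>A\<close> acts on the range of \<open>E b\<close> as a bounded
  operator.\<close>

lemma scalar_type_spectral_bounded_part:
  fixes A :: "'a::cbanach \<Rightarrow> 'a"
  assumes scal: "scalar_type_spectral D A E"
    and b: "b \<in> sets borel" "b \<subseteq> spectrum D A" "bounded b"
  obtains B where "has_bounded_spectral_integral E (\<lambda>z. if z \<in> b then z else 0) B"
    and "\<And>x. E b x = x \<Longrightarrow> x \<in> D \<and> A x = B x"
proof -
  have E: "spectral_measure E" and lin: "linear_operator D A"
    and A_iff: "\<And>x y. x \<in> D \<and> A x = y \<longleftrightarrow> has_spectral_integral E (spectrum D A) (\<lambda>z. z) x y"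
    using scal by (auto simp: scalar_type_spectral_def closed_operator_def)
  define F where "F n z = (if z \<in> spectrum D A \<and> cmod z \<le> real n then z else 0)" for n z
  \<comment> \<open>Since \<open>0\<close> is in the domain, the truncated integrals exist as bounded operators, independently of \<open>x\<close>.\<close>
  have "has_spectral_integral E (spectrum D A) (\<lambda>z. z) 0 (A 0)"
    using A_iff lin by (auto simp: linear_operator_def)
  then obtain S where S: "\<And>n. has_bounded_spectral_integral E (F n) (S n)"
    by (auto simp: has_spectral_integral_def F_def[abs_def])
  obtain N where N: "\<And>z. z \<in> b \<Longrightarrow> cmod z \<le> real N"
  proof -
    obtain r where r: "\<forall>z\<in>b. cmod z \<le> r" using b(3) by (auto simp: bounded_iff)
    obtain N where "r \<le> real N" using real_arch_simple by blast
    with r show ?thesis by (intro that[of N]) (auto intro: order_trans)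
  qed
  have int: "has_bounded_spectral_integral E (\<lambda>z. if z \<in> b then z else 0) (S n o\<^sub>L E b)" if "n \<ge> N" for n
  proof -
    have "cmod z \<le> real n" if "z \<in> b" for z
      using N[OF that] \<open>n \<ge> N\<close> by linarith
    hence "(\<lambda>z. if z \<in> b then F n z else 0) = (\<lambda>z. if z \<in> b then z else 0)"
      using b(2) by (auto simp: F_def fun_eq_iff)
    thus ?thesis using has_bounded_spectral_integral_restrict[OF E b(1) S[of n]] by simp
  qed
  have eq: "S n o\<^sub>L E b = S N o\<^sub>L E b" if "n \<ge> N" for n
    by (rule bounded_spectral_integral_unique[OF E int[OF that] int[OF order_refl]])
  show ?thesis
  proof (rule that)
    show "has_bounded_spectral_integral E (\<lambda>z. if z \<in> b then z else 0) (S N o\<^sub>L E b)"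
      by (rule int) simp
    fix x assume x: "E b x = x"
    have S_x: "S n x = S N x" if "n \<ge> N" for n
      using arg_cong[OF eq[OF that], of "\<lambda>f. blinfun_apply f x"] x by simp
    have "(\<lambda>n. S n x) \<longlonglongrightarrow> S N x"
      by (rule tendsto_eventually, rule eventually_sequentiallyI[of N], rule S_x)
    hence "has_spectral_integral E (spectrum D A) (\<lambda>z. z) x (S N x)"
      unfolding has_spectral_integral_def
      using S unfolding F_def[abs_def] by (intro exI[of _ S] conjI allI)
    hence "x \<in> D \<and> A x = S N x" using A_iff by blast
    thus "x \<in> D \<and> A x = (S N o\<^sub>L E b) x" using x by simp
  qed
qed

text \<open>The projection of a small disc around \<open>\<mu>\<close> is nonzero because \<open>\<mu>\<close> is in the support. On its range
  \<open>A - \<mu>\<close> is the integral of a function that is small in the supremum norm.\<close>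

lemma spectrum_approximate_eigenvector:
  fixes A :: "'a::cbanach \<Rightarrow> 'a"
  assumes scal: "scalar_type_spectral D A E" and \<mu>: "\<mu> \<in> spectrum D A" and "e > 0"
  obtains x where "x \<in> D" "norm x = 1" "norm (A x - \<mu> *\<^sub>C x) \<le> e"
proof -
  have E: "spectral_measure E" and supp: "spectral_support E = spectrum D A"
    using scal by (auto simp: scalar_type_spectral_def)
  obtain M where M: "\<And>\<delta>. \<delta> \<in> sets borel \<Longrightarrow> norm (E \<delta>) \<le> M"
    using spectral_measure_bounded[OF E] by (auto simp: bdd_above_def)
  have "0 \<le> M" using order_trans[OF norm_ge_zero M[of "{}"]] by simp
  define r where "r = e / (4 * M + 1)"
  have r: "r > 0" "4 * M * r \<le> e" using \<open>e > 0\<close> \<open>0 \<le> M\<close> by (auto simp: r_def field_simps)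
  \<comment> \<open>Outside the spectrum the integrand is \<open>0\<close> rather than \<open>z\<close>, so the disc has to be cut down to the spectrum.\<close>
  define b where "b = ball \<mu> r \<inter> spectrum D A"
  have b: "b \<in> sets borel" "b \<subseteq> spectrum D A" "bounded b"
    using scalar_type_spectral_Int_spectrum(1)[OF scal, of "{}"] by (auto simp: b_def bounded_Int)
  have "E (ball \<mu> r) \<noteq> 0"
    using \<mu> r(1) unfolding supp[symmetric] spectral_support_def by auto
  hence "E b \<noteq> 0" using scalar_type_spectral_Int_spectrum(2)[OF scal, of "ball \<mu> r"] by (simp add: b_def)
  then obtain y where y: "E b y \<noteq> 0" by (metis blinfun_eqI zero_blinfun.rep_eq)
  define x where "x = E b y /\<^sub>R norm (E b y)"
  have x: "norm x = 1" "E b x = x"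
    using y spectral_measure_apply[OF E b(1) b(1)] by (auto simp: x_def blinfun.scaleR_right)
  obtain B where B: "has_bounded_spectral_integral E (\<lambda>z. if z \<in> b then z else 0) B"
    and AB: "\<And>x. E b x = x \<Longrightarrow> x \<in> D \<and> A x = B x"
    using scalar_type_spectral_bounded_part[OF scal b] by blast
  have "norm (B - \<mu> *\<^sub>C E b) \<le> 4 * M * r"
  proof (rule norm_bounded_spectral_integral_le[OF E M])
    show "has_bounded_spectral_integral E
        (\<lambda>z. (if z \<in> b then z else 0) - (if z \<in> b then \<mu> else 0)) (B - \<mu> *\<^sub>C E b)"
      by (intro has_bounded_spectral_integral_diff[OF E B]
          has_bounded_spectral_integral_const_on[OF E b(1)])
    show "cmod ((if z \<in> b then z else 0) - (if z \<in> b then \<mu> else 0)) \<le> r" for z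
      using r(1) by (auto simp: b_def dist_norm norm_minus_commute)
  qed
  hence "norm ((B - \<mu> *\<^sub>C E b) x) \<le> e"
    using norm_blinfun[of "B - \<mu> *\<^sub>C E b" x] x r(2) by simp
  hence "norm (A x - \<mu> *\<^sub>C x) \<le> e"
    using AB[OF x(2)] x(2) by (simp add: blinfun.diff_left scaleC_blinfun.rep_eq)
  with AB[OF x(2)] x(1) show ?thesis by (intro that) auto
qed

section \<open>Exponential bounds in terms of the spectrum\<close>

text \<open>For an approximate eigenvector \<open>x\<close>, the vector \<open>T t x\<close> is close to \<open>exp (t \<mu>) x\<close>, with an error that for
  fixed \<open>t\<close> vanishes with \<open>A x - \<mu> x\<close>.\<close>

theorem exp_Re_spectrum_le_norm_semigroup:
  fixes T :: "real \<Rightarrow> 'a::cbanach \<Rightarrow>\<^sub>L 'a"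
  assumes T: "C0_semigroup T" and gen: "generates D A T" and scal: "scalar_type_spectral D A E"
    and \<mu>: "\<mu> \<in> spectrum D A" and t: "t \<ge> 0"
  shows "exp (Re \<mu> * t) \<le> norm (T t)"
proof -
  obtain K where K: "K \<ge> 1" "\<And>r. 0 \<le> r \<Longrightarrow> r \<le> t \<Longrightarrow> norm (T r) \<le> K"
    using C0_semigroup_locally_bounded[OF T] by metis
  define Q where "Q = K * exp (\<bar>Re \<mu>\<bar> * t)"
  have "exp (Re \<mu> * t) \<le> norm (T t) + e * Q * t" if e: "e > 0" for e
  proof -
    obtain x where x: "x \<in> D" "norm x = 1" "norm (A x - \<mu> *\<^sub>C x) \<le> e"
      using spectrum_approximate_eigenvector[OF scal \<mu> e] by blast
    have "norm (T (t - r) (exp (of_real r * \<mu>) *\<^sub>C (\<mu> *\<^sub>C x - A x))) \<le> e * Q" if r: "0 \<le> r" "r \<le> t" for r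
    proof -
      have "norm (T (t - r) (exp (of_real r * \<mu>) *\<^sub>C (\<mu> *\<^sub>C x - A x)))
          \<le> norm (T (t - r)) * (exp (r * Re \<mu>) * norm (\<mu> *\<^sub>C x - A x))"
        using norm_blinfun[of "T (t - r)" "exp (of_real r * \<mu>) *\<^sub>C (\<mu> *\<^sub>C x - A x)"]
        by (simp add: norm_scaleC norm_exp_eq_Re)
      also have "\<dots> \<le> K * (exp (\<bar>Re \<mu>\<bar> * t) * e)"
      proof (intro mult_mono)
        have "r * Re \<mu> \<le> r * \<bar>Re \<mu>\<bar>" using r by (intro mult_left_mono) auto
        also have "\<dots> \<le> t * \<bar>Re \<mu>\<bar>" using r by (intro mult_right_mono) auto
        finally show "exp (r * Re \<mu>) \<le> exp (\<bar>Re \<mu>\<bar> * t)" by (simp add: mult.commute)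
        show "norm (\<mu> *\<^sub>C x - A x) \<le> e" using x(3) by (simp add: norm_minus_commute)
      qed (use K r in auto)
      finally show ?thesis by (simp add: Q_def mult_ac)
    qed
    hence "norm (exp (of_real t * \<mu>) *\<^sub>C x - T t x) \<le> e * Q * t"
      using semigroup_comparison[OF T gen t, of "{()}" "\<lambda>_. x" "\<lambda>_. \<mu>"] x by simp
    moreover have "norm (exp (of_real t * \<mu>) *\<^sub>C x) = exp (Re \<mu> * t)"
      using x by (simp add: norm_scaleC norm_exp_eq_Re mult.commute)
    moreover have "norm (T t x) \<le> norm (T t)" using norm_blinfun[of "T t" x] x by simp
    ultimately show ?thesis
      using norm_triangle_sub[of "exp (of_real t * \<mu>) *\<^sub>C x" "T t x"] by simp
  qed
  hence "\<forall>\<^sub>F e in at_right 0. exp (Re \<mu> * t) \<le> norm (T t) + e * Q * t"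
    by (intro eventually_at_right_less[THEN eventually_mono]) auto
  moreover have "((\<lambda>e. norm (T t) + e * Q * t) \<longlongrightarrow> norm (T t) + 0 * Q * t) (at_right 0)"
    by (intro tendsto_intros)
  ultimately show ?thesis
    using tendsto_lowerbound[of "\<lambda>e. norm (T t) + e * Q * t"] by simp
qed

text \<open>The exponential sum \<open>U t x\<close> built from a simple function within \<open>e\<close> of the identity on \<open>b\<close> satisfies
  the estimate with \<open>\<omega> + e\<close> in place of \<open>\<omega>\<close>, and differs from \<open>T t x\<close> by a constant times \<open>e\<close>. The
  constant \<open>Q\<close> bounds \<open>\<parallel>U r x\<parallel>\<close> for all \<open>r \<le> t\<close> and \<open>e < 1\<close>, so that \<open>e\<close> can tend to \<open>0\<close>.\<close>

lemma norm_semigroup_le_on_bounded_part: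
  fixes T :: "real \<Rightarrow> 'a::cbanach \<Rightarrow>\<^sub>L 'a"
  assumes T: "C0_semigroup T" and gen: "generates D A T" and scal: "scalar_type_spectral D A E"
    and M: "\<And>\<delta>. \<delta> \<in> sets borel \<Longrightarrow> norm (E \<delta>) \<le> M"
    and \<omega>: "\<And>z. z \<in> spectrum D A \<Longrightarrow> Re z \<le> \<omega>"
    and b: "b \<in> sets borel" "b \<subseteq> spectrum D A" "bounded b"
    and x: "E b x = x" and t: "t \<ge> 0"
  shows "norm (T t x) \<le> 4 * M * exp (\<omega> * t) * norm x"
proof -
  have E: "spectral_measure E" and lin: "linear_operator D A"
    using scal by (auto simp: scalar_type_spectral_def closed_operator_def)
  have M0: "M \<ge> 0" using order_trans[OF norm_ge_zero M[of "{}"]] by simp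
  obtain K where K: "K \<ge> 1" "\<And>r. 0 \<le> r \<Longrightarrow> r \<le> t \<Longrightarrow> norm (T r) \<le> K"
    using C0_semigroup_locally_bounded[OF T] by metis
  obtain B where B: "has_bounded_spectral_integral E (\<lambda>z. if z \<in> b then z else 0) B"
    and AB: "\<And>x. E b x = x \<Longrightarrow> x \<in> D \<and> A x = B x"
    using scalar_type_spectral_bounded_part[OF scal b] by blast
  obtain f where f: "\<forall>n. simple_function borel (f n)"
    "uniform_limit UNIV f (\<lambda>z. if z \<in> b then z else 0) sequentially"
    "(\<lambda>n. simple_spectral_integral E (f n)) \<longlonglongrightarrow> B"
    using B by (auto simp: has_bounded_spectral_integral_def)
  define Q where "Q = 4 * M * exp ((\<bar>\<omega>\<bar> + 1) * t) * norm x"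
  have "norm (T t x) \<le> 4 * M * exp ((\<omega> + e) * t) * norm x + K * e * Q * t" if e: "0 < e" "e < 1" for e
  proof -
    have "\<forall>\<^sub>F n in sequentially. \<forall>z\<in>UNIV. dist (f n z) (if z \<in> b then z else 0) < e"
      using f(2) e by (simp add: uniform_limit_iff)
    moreover have "\<forall>\<^sub>F n in sequentially. dist (simple_spectral_integral E (f n)) B < e"
      using f(3) e by (simp add: tendsto_iff)
    ultimately have "\<forall>\<^sub>F n in sequentially. (\<forall>z\<in>UNIV. dist (f n z) (if z \<in> b then z else 0) < e)
        \<and> dist (simple_spectral_integral E (f n)) B < e"
      by eventually_elim auto
    then obtain n where n: "\<forall>z\<in>UNIV. dist (f n z) (if z \<in> b then z else 0) < e"
        "dist (simple_spectral_integral E (f n)) B < e"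
      by (auto simp: eventually_sequentially)
    define s where "s = f n"
    define S where "S = simple_spectral_integral E s"
    have s: "simple_function borel s" using f(1) by (simp add: s_def)
    have SB: "norm (S - B) \<le> e" using n(2) by (simp add: S_def s_def dist_norm)
    define I where "I = s ` b"
    \<comment> \<open>Only the part of a level set inside \<open>b\<close> counts: values taken outside \<open>b\<close> alone may have a real part above \<open>\<omega> + e\<close>.\<close>
    define d where "d c = s -` {c} \<inter> b" for c
    define v where "v c = E (d c) x" for c
    have I: "finite I" and d: "\<And>c. d c \<in> sets borel" "disjoint_family_on d I" "(\<Union>c\<in>I. d c) = b"
      using simple_functionD[OF s] b(1) finite_subset[of "s ` b" "range s"]
      by (auto simp: I_def d_def disjoint_family_on_def)
    have v: "E b (v c) = v c" "S (a *\<^sub>C v c) = c *\<^sub>C a *\<^sub>C v c" for a c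
    proof -
      have "b \<inter> d c = d c" by (auto simp: d_def)
      thus "E b (v c) = v c" using spectral_measure_apply[OF E b(1) d(1)] by (simp add: v_def)
      have "(\<lambda>z. if z \<in> d c then s z else 0) = (\<lambda>z. if z \<in> d c then c else 0)"
        by (auto simp: d_def)
      hence "has_bounded_spectral_integral E (\<lambda>z. if z \<in> d c then c else 0) (S o\<^sub>L E (d c))"
        using has_bounded_spectral_integral_restrict[OF E d(1)[of c]
            has_bounded_spectral_integral_simple[OF s]] by (simp add: S_def)
      hence "S o\<^sub>L E (d c) = c *\<^sub>C E (d c)"
        by (rule bounded_spectral_integral_unique[OF E _ has_bounded_spectral_integral_const_on[OF E d(1)]])
      from arg_cong[OF this, of "\<lambda>f. blinfun_apply f (a *\<^sub>C x)"]
      show "S (a *\<^sub>C v c) = c *\<^sub>C a *\<^sub>C v c"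
        using spectral_measure_scaleC[OF E d(1)] by (simp add: v_def scaleC_blinfun.rep_eq)
    qed
    have sum_v: "(\<Sum>c\<in>I. v c) = x"
      using spectral_measure_UN_finite[OF E I d(1,2)] d(3) x
      by (simp add: v_def flip: blinfun.sum_left)
    define U where "U r = (\<Sum>c\<in>I. exp (of_real r * c) *\<^sub>C E (d c))" for r
    have U_x: "U r x = (\<Sum>c\<in>I. exp (of_real r * c) *\<^sub>C v c)" for r
      by (simp add: U_def v_def blinfun.sum_left scaleC_blinfun.rep_eq)
    have Re: "Re c \<le> \<omega> + e" if c: "c \<in> I" for c
    proof -
      obtain z where z: "z \<in> b" "c = s z" using c by (auto simp: I_def)
      have "Re c - Re z \<le> cmod (c - z)" using complex_Re_le_cmod[of "c - z"] by simp
      also have "\<dots> \<le> e" using n(1)[rule_format, of z] z by (simp add: s_def dist_norm)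
      finally show ?thesis using \<omega>[of z] z b(2) by auto
    qed
    have U: "norm (U r x) \<le> 4 * M * exp ((\<omega> + e) * r) * norm x" if "r \<ge> 0" for r
    proof -
      have "norm (U r) \<le> 4 * M * exp ((\<omega> + e) * r)"
        unfolding U_def
      proof (rule norm_spectral_sum_le[OF E M I d(1,2)])
        fix c assume "c \<in> I"
        from mult_left_mono[OF Re[OF this] that]
        show "cmod (exp (of_real r * c)) \<le> exp ((\<omega> + e) * r)"
          by (simp add: norm_exp_eq_Re mult.commute)
      qed auto
      thus ?thesis
        by (meson mult_right_mono norm_blinfun norm_ge_zero order_trans)
    qed
    have "norm (T (t - r) (\<Sum>c\<in>I. exp (of_real r * c) *\<^sub>C (c *\<^sub>C v c - A (v c)))) \<le> K * e * Q"
      if r: "0 \<le> r" "r \<le> t" for r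
    proof -
      \<comment> \<open>The scalar is kept inside the argument of \<open>S - B\<close>: complex linearity comes from \<open>A\<close> and from the projections.\<close>
      have "a *\<^sub>C (c *\<^sub>C v c - A (v c)) = (S - B) (a *\<^sub>C v c)" for a c
      proof -
        have "v c \<in> D" using AB v(1) by blast
        moreover have "E b (a *\<^sub>C v c) = a *\<^sub>C v c"
          using spectral_measure_scaleC[OF E b(1)] v(1) by simp
        ultimately have "B (a *\<^sub>C v c) = a *\<^sub>C A (v c)"
          using AB[of "a *\<^sub>C v c"] lin by (auto simp: linear_operator_def)
        thus ?thesis
          by (simp add: v(2) blinfun.diff_left scaleC.diff_right scaleC_scaleC mult.commute)
      qed
      hence eq: "(\<Sum>c\<in>I. exp (of_real r * c) *\<^sub>C (c *\<^sub>C v c - A (v c))) = (S - B) (U r x)"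
        by (simp add: U_x blinfun.sum_right)
      have "(\<omega> + e) * r \<le> (\<bar>\<omega>\<bar> + 1) * t"
        using e r by (intro mult_mono) auto
      hence "4 * M * exp ((\<omega> + e) * r) * norm x \<le> Q"
        unfolding Q_def using M0 by (intro mult_right_mono mult_left_mono) auto
      with U[OF r(1)] have Q: "norm (U r x) \<le> Q" by linarith
      have "norm (T (t - r) ((S - B) (U r x))) \<le> norm (T (t - r)) * (norm (S - B) * norm (U r x))"
        by (meson mult_left_mono norm_blinfun norm_ge_zero order_trans)
      also have "\<dots> \<le> K * (e * Q)"
        using K r e SB Q by (intro mult_mono) auto
      finally show ?thesis by (simp add: eq mult.assoc)
    qed
    hence "norm (U t x - T t x) \<le> K * e * Q * t"
      using semigroup_comparison[OF T gen t, of I v "\<lambda>c. c"] AB v(1) by (simp add: U_x sum_v)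
    with U[OF t] norm_triangle_sub[of "T t x" "U t x"] show ?thesis
      by (simp add: norm_minus_commute)
  qed
  hence "\<forall>\<^sub>F e in at_right 0.
      norm (T t x) \<le> 4 * M * exp ((\<omega> + e) * t) * norm x + K * e * Q * t"
    using eventually_at_right_real[of 0 1] by (auto elim!: eventually_mono)
  moreover have "((\<lambda>e. 4 * M * exp ((\<omega> + e) * t) * norm x + K * e * Q * t)
      \<longlongrightarrow> 4 * M * exp ((\<omega> + 0) * t) * norm x + K * 0 * Q * t) (at_right 0)"
    by (intro tendsto_intros)
  ultimately show ?thesis
    using tendsto_lowerbound[of "\<lambda>e. 4 * M * exp ((\<omega> + e) * t) * norm x + K * e * Q * t"] by simp
qed

text \<open>Discs of growing radius exhaust the plane, so every \<open>x\<close> is the limit of its projections to bounded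
  parts of the spectrum.\<close>

theorem norm_semigroup_le:
  fixes T :: "real \<Rightarrow> 'a::cbanach \<Rightarrow>\<^sub>L 'a"
  assumes T: "C0_semigroup T" and gen: "generates D A T" and scal: "scalar_type_spectral D A E"
    and M: "\<And>\<delta>. \<delta> \<in> sets borel \<Longrightarrow> norm (E \<delta>) \<le> M"
    and \<omega>: "\<And>z. z \<in> spectrum D A \<Longrightarrow> Re z \<le> \<omega>" and t: "t \<ge> 0"
  shows "norm (T t) \<le> 4 * M * exp (\<omega> * t)"
proof (rule norm_blinfun_bound)
  have E: "spectral_measure E" using scal by (auto simp: scalar_type_spectral_def)
  show "0 \<le> 4 * M * exp (\<omega> * t)" using order_trans[OF norm_ge_zero M[of "{}"]] by simp
  fix x
  define b where "b n = cball 0 (real n) \<inter> spectrum D A" for n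
  have b: "b n \<in> sets borel" "b n \<subseteq> spectrum D A" "bounded (b n)" for n
    using scalar_type_spectral_Int_spectrum(1)[OF scal, of "{}"] by (auto simp: b_def bounded_Int)
  have "(\<Union>n. cball 0 (real n)) = (UNIV :: complex set)"
    using real_arch_simple by auto
  moreover have "mono (\<lambda>n. cball (0::complex) (real n))" by (auto simp: mono_def)
  ultimately have "(\<lambda>n. E (cball 0 (real n)) x) \<longlonglongrightarrow> E UNIV x"
    using spectral_measure_LIMSEQ[OF E, of "\<lambda>n. cball 0 (real n)" x] by simp
  moreover have "E (b n) = E (cball 0 (real n))" for n
    using scalar_type_spectral_Int_spectrum(2)[OF scal, of "cball 0 (real n)"] by (simp add: b_def)
  ultimately have lim: "(\<lambda>n. E (b n) x) \<longlonglongrightarrow> x"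
    by (simp add: spectral_measure_UNIV[OF E])
  have "norm (T t (E (b n) x)) \<le> 4 * M * exp (\<omega> * t) * norm (E (b n) x)" for n
    by (rule norm_semigroup_le_on_bounded_part[OF T gen scal M \<omega> b[of n] _ t])
       (simp_all add: spectral_measure_apply[OF E b(1) b(1)])
  thus "norm (T t x) \<le> 4 * M * exp (\<omega> * t) * norm x"
    by (intro tendsto_le[OF _ tendsto_mult_left[OF tendsto_norm[OF lim]]
          tendsto_norm[OF blinfun.tendsto[OF tendsto_const lim]]]) auto
qed

theorem proposition3p1:
  fixes T :: "real \<Rightarrow> 'a::cbanach \<Rightarrow>\<^sub>L 'a"
    and D :: "'a set" and A :: "'a \<Rightarrow> 'a"
    and E :: "complex set \<Rightarrow> 'a \<Rightarrow>\<^sub>L 'a"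
    and M\<^sub>0 :: real
  assumes "(UNIV :: 'a set) \<noteq> {0}"
    and "C0_semigroup T"
    and "scalar_type_spectral D A E"
    and "generates D A T"
  defines "M\<^sub>0 \<equiv> (SUP \<delta>\<in>sets borel. norm (E \<delta>))"
  shows "bdd_above ((\<lambda>\<delta>. norm (E \<delta>)) ` sets borel) \<and> M\<^sub>0 \<ge> 1 \<and>
    (\<exists>\<omega>\<^sub>0 :: real. growth_bound T = ereal \<omega>\<^sub>0 \<and> spectral_bound D A = ereal \<omega>\<^sub>0 \<and>
       (\<forall>t\<ge>0. norm (T t) \<le> 4 * M\<^sub>0 * exp (\<omega>\<^sub>0 * t)) \<and>
       \<omega>\<^sub>0 \<in> growth_exponents T \<and> (\<forall>\<omega>\<in>growth_exponents T. \<omega>\<^sub>0 \<le> \<omega>))"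
proof -
  note T = assms(2) and scal = assms(3) and gen = assms(4)
  have E: "spectral_measure E" using scal by (auto simp: scalar_type_spectral_def)
  have bdd: "bdd_above ((\<lambda>\<delta>. norm (E \<delta>)) ` sets borel)" by (rule spectral_measure_bounded[OF E])
  have M: "norm (E \<delta>) \<le> M\<^sub>0" if "\<delta> \<in> sets borel" for \<delta>
    unfolding M\<^sub>0_def by (rule cSUP_upper[OF that bdd])
  obtain y :: 'a where y: "y \<noteq> 0" using assms(1) by auto
  have id: "norm (id_blinfun :: 'a \<Rightarrow>\<^sub>L 'a) \<ge> 1"
    using norm_blinfun[of "id_blinfun :: 'a \<Rightarrow>\<^sub>L 'a" y] y by simp
  hence M1: "M\<^sub>0 \<ge> 1" using M[of UNIV] by (simp add: spectral_measure_UNIV[OF E])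

  have ne: "spectrum D A \<noteq> {}"
  proof
    assume "spectrum D A = {}"
    hence "E UNIV = E {}" using scalar_type_spectral_Int_spectrum(2)[OF scal, of UNIV] by simp
    thus False using id by (simp add: spectral_measure_UNIV[OF E] spectral_measure_empty[OF E])
  qed
  have Re_le: "Re z \<le> \<omega>" if z: "z \<in> spectrum D A" and \<omega>: "\<omega> \<in> growth_exponents T" for z \<omega>
  proof (rule ccontr)
    assume less: "\<not> Re z \<le> \<omega>"
    obtain C where C: "C \<ge> 1" "\<And>t. t \<ge> 0 \<Longrightarrow> norm (T t) \<le> C * exp (\<omega> * t)"
      using \<omega> by (auto simp: growth_exponents_def)
    \<comment> \<open>With \<open>t = C / (Re z - \<omega>)\<close> the two exponential bounds combine to \<open>exp C \<le> C\<close>.\<close>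
    define t where "t = C / (Re z - \<omega>)"
    have t: "t \<ge> 0" using C less by (simp add: t_def)
    have "exp (Re z * t) \<le> C * exp (\<omega> * t)"
      using exp_Re_spectrum_le_norm_semigroup[OF T gen scal z t] C(2)[OF t] by linarith
    hence "exp ((Re z - \<omega>) * t) \<le> C"
      by (simp add: left_diff_distrib exp_diff field_simps)
    hence "exp C \<le> C" using less by (simp add: t_def)
    thus False using exp_ge_add_one_self[of C] by linarith
  qed
  have "growth_exponents T \<noteq> {}"
    using C0_semigroup_exponential_bound[OF T] unfolding growth_exponents_def by blast
  then obtain \<omega>' where \<omega>': "\<omega>' \<in> growth_exponents T" by blast
  define s where "s = (SUP z\<in>spectrum D A. Re z)"
  have bdd_Re: "bdd_above (Re ` spectrum D A)"
    using Re_le[OF _ \<omega>'] by (auto intro!: bdd_aboveI2)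
  have s: "Re z \<le> s" if "z \<in> spectrum D A" for z
    unfolding s_def by (rule cSUP_upper[OF that bdd_Re])
  have s_least: "s \<le> \<omega>" if "\<omega> \<in> growth_exponents T" for \<omega>
    unfolding s_def using ne Re_le that by (intro cSUP_least) auto

  have bound: "norm (T t) \<le> 4 * M\<^sub>0 * exp (s * t)" if "t \<ge> 0" for t
    by (rule norm_semigroup_le[OF T gen scal M s that])
  hence s_in: "s \<in> growth_exponents T"
    using M1 by (auto simp: growth_exponents_def intro!: exI[of _ "4 * M\<^sub>0"])
  have "growth_bound T = ereal s"
    unfolding growth_bound_def using s_in s_least by (intro antisym INF_lower INF_greatest) auto
  moreover have "spectral_bound D A = ereal s"
  proof -
    obtain z where z: "z \<in> spectrum D A" using ne by blast
    have "\<bar>SUP z\<in>spectrum D A. ereal (Re z)\<bar> \<noteq> \<infinity>"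
    proof -
      have "(SUP z\<in>spectrum D A. ereal (Re z)) \<le> ereal s" using s by (intro SUP_least) auto
      moreover have "ereal (Re z) \<le> (SUP z\<in>spectrum D A. ereal (Re z))" using z by (rule SUP_upper)
      ultimately show ?thesis by (cases "SUP z\<in>spectrum D A. ereal (Re z)") auto
    qed
    thus ?thesis by (simp add: spectral_bound_def s_def ereal_SUP)
  qed
  ultimately show ?thesis using bdd M1 bound s_in s_least by blast
qed

end
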